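(* Let $M$ be a lattice of rank $n\ge1$, let $p\in\mathbb{C}[M]$ be a Laurent polynomial with $\operatorname{supp}(p)$ unimodular, and let $\tau\in\Sigma^{1}$ be a ray of the normal fan $\Sigma=\Sigma_{\operatorname{NP}(p)}$. Then $$\operatorname{init}_{\tau}(\mu(p))=\mu(\operatorname{init}_{\tau}(p))\cdot p|_{F'_{\tau}},$$ where $F'_{\tau}$ is the adjacent polytope of the facet $F_{\tau}=\operatorname{NP}(p)_\tau$ of $\operatorname{NP}(p)$.
   Context: $M_{\mathbb{R}}=M\otimes_{\mathbb{Z}}\mathbb{R}$, $N=M^{\vee}$ is the dual lattice, $N_{\mathbb{R}}=N\otimes_{\mathbb{Z}}\mathbb{R}$, and $\langle\cdot,\cdot\rangle$ is the pairing. $\mathbb{C}[M]$ is the group algebra, with monomials $\chi^{m}$. For a nonzero $p=\sum_{j=0}^{s}c_{j}\chi^{m_{j}}$ ($c_{j}\ne0$, $m_{j}$ distinct), $\operatorname{supp}(p)=\{m_{0},\dots,m_{s}\}$ and $\operatorname{NP}(p)=\operatorname{conv}(\operatorname{supp}(p))$. A finite subset $S\subset M$ is unimodular if for every vertex $v$ of $\operatorname{conv}(S)$ and every edge $E$ of $\operatorname{conv}(S)$ containing $v$ there exists $w_{E}\in E\cap S$ such that the vectors $w_{E}-v$ (over all such edges $E$) form a basis of $M$. For a face $F$ of $\operatorname{NP}(p)$, $\sigma_{F}=\{u\in N_{\mathbb{R}}\mid\langle u,x-y\rangle\ge0\text{ for all }x\in\operatorname{NP}(p),\,y\in F\}$;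 the normal fan is $\Sigma_{\operatorname{NP}(p)}=\{\sigma_{F}\}_{F}$, and $\Sigma^{1}$ is its set of rays. For a cone $\sigma\subset N_{\mathbb{R}}$ and a compact $C\subset M_{\mathbb{R}}$, $C_{\sigma}=\{y\in C\mid\langle u,x-y\rangle\ge0\text{ for all }u\in\sigma,\,x\in C\}$. For $S\subset M_{\mathbb{R}}$, $p|_{S}=\sum_{m_{j}\in S}c_{j}\chi^{m_{j}}$. The initial part is $\operatorname{init}_{\sigma}(p)=p|_{\operatorname{NP}(p)_{\sigma}}$. For an $n$-dimensional lattice polytope $\Delta\subset M_{\mathbb{R}}$ and a facet $F$ of it with primitive inner normal vector $u_{F}\in N$, the adjacent polytope of $F$ is $F'=\{x\in\Delta\mid\langle u_{F},x-y\rangle=1\text{ for all }y\in F\}$. The operator $\mu$: for a nonzero Laurent polynomial $p=\sum_{j=0}^{s}c_{j}\chi^{m_{j}}\in\mathbb{C}[M]$ with $c_{j}\ne0$ for all $j$ and $m_{0},\dots,m_{s}\in M$ distinct, let $M_{p}=M\cap\sum_{j,k}\mathbb{R}(m_{j}-m_{k})$ and $r=\operatorname{rank}(M_{p})$. Choosing a basis of $M_{p}$ identifies $\mathbb{C}[M_{p}]$ with $\mathbb{C}[y_{1}^{\pm1},\dots,y_{r}^{\pm1}]$; with $D_{i}=y_{i}\,\partial/\partial y_{i}$ one sets, for $q\ne0$, $\delta_{M_{p}}(q)=\det(D_{i}D_{j}\log q)_{i,j=1}^{r}$, where $D_{i}D_{j}\log q=\big(q\,D_{i}D_{j}q-(D_{i}q)(D_{j}q)\big)/q^{2}$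 (independent of the basis; the empty determinant is $1$). Then $\mu(p)=p^{r+1}\,\delta_{M_{p}}(\chi^{-m_{0}}p)$, a Laurent polynomial in $\mathbb{C}[M]$ independent of the choice of $m_{0}\in\operatorname{supp}(p)$. Note that $\mu(\operatorname{init}_{\tau}(p))$ is computed with respect to the lattice $M_{\operatorname{init}_{\tau}(p)}$. *)

theory Defs
  imports "HOL-Analysis.Analysis" "HOL-Library.Poly_Mapping"
    "HOL-Computational_Algebra.Polynomial_Factorial"
    "Jordan_Normal_Form.Determinant"
begin

section \<open>Lattices\<close>

text \<open>
  A lattice of rank \<open>n\<close> is represented inside its real form: the type \<open>'a :: euclidean_space\<close>
  plays the role of \<open>M\<^sub>\<real>\<close>, so \<open>n = DIM('a) \<ge> 1\<close>, and \<open>M\<close> is the set of integer combinations of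
  some real basis of \<open>'a\<close> (any one, so no coordinates are preferred). The inner product
  identifies \<open>N\<^sub>\<real>\<close> with \<open>'a\<close> and is then the pairing between \<open>N\<^sub>\<real>\<close> and \<open>M\<^sub>\<real>\<close>.
\<close>

definition int_span :: "'a::real_vector set \<Rightarrow> 'a set" where
  "int_span B = {x. \<exists>c :: 'a \<Rightarrow> int. x = (\<Sum>b\<in>B. of_int (c b) *\<^sub>R b)}"

definition lattice_basis :: "'a::euclidean_space set \<Rightarrow> 'a set \<Rightarrow> bool" where
  "lattice_basis B L \<longleftrightarrow> independent B \<and> L = int_span B"

definition full_lattice :: "'a::euclidean_space set \<Rightarrow> bool" where
  "full_lattice M \<longleftrightarrow> (\<exists>B. lattice_basis B M \<and> span B = UNIV)"

definition dual_lattice :: "'a::euclidean_space set \<Rightarrow> 'a set" where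
  "dual_lattice M = {u. \<forall>m\<in>M. inner u m \<in> \<int>}"

definition primitive_vector :: "'a::euclidean_space set \<Rightarrow> 'a \<Rightarrow> bool" where
  "primitive_vector L u \<longleftrightarrow>
     u \<in> L \<and> u \<noteq> 0 \<and> (\<forall>(k::int) w. w \<in> L \<and> u = of_int k *\<^sub>R w \<longrightarrow> \<bar>k\<bar> = 1)"

text \<open>
  An arbitrary ordered basis; \<open>delta\<close> below does not depend on the choice.
\<close>

definition chosen_basis :: "'a::euclidean_space set \<Rightarrow> 'a list" where
  "chosen_basis L = (SOME bs. distinct bs \<and> lattice_basis (set bs) L)"

definition lattice_rank :: "'a::euclidean_space set \<Rightarrow> nat" where
  "lattice_rank L = length (chosen_basis L)"


section \<open>Polytopes, cones and unimodular sets\<close>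

text \<open>
  The family \<open>(w\<^sub>E - v)\<^sub>E\<close> is a basis as an indexed family: its members are distinct and they
  form a basis.
\<close>

definition unimodular :: "'a::euclidean_space set \<Rightarrow> 'a set \<Rightarrow> bool" where
  "unimodular M S \<longleftrightarrow> finite S \<and> S \<subseteq> M \<and>
     (\<forall>v. v extreme_point_of (convex hull S) \<longrightarrow>
        (let \<E> = {E. E edge_of (convex hull S) \<and> v \<in> E} in
           \<exists>w. (\<forall>E\<in>\<E>. w E \<in> E \<inter> S) \<and>
               inj_on (\<lambda>E. w E - v) \<E> \<and>
               lattice_basis ((\<lambda>E. w E - v) ` \<E>) M))"

definition normal_cone :: "'a::euclidean_space set \<Rightarrow> 'a set \<Rightarrow> 'a set" where
  "normal_cone P F = {u. \<forall>x\<in>P. \<forall>y\<in>F. 0 \<le> inner u (x - y)}"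

text \<open>The library counts the empty set as a face; it does not contribute a cone.\<close>

definition normal_fan :: "'a::euclidean_space set \<Rightarrow> 'a set set" where
  "normal_fan P = {normal_cone P F | F. F face_of P \<and> F \<noteq> {}}"

definition rays :: "'a::euclidean_space set set \<Rightarrow> 'a set set" where
  "rays \<Sigma> = {\<sigma> \<in> \<Sigma>. dim \<sigma> = 1}"

text \<open>\<open>cone_face C \<sigma>\<close> is \<open>C\<^sub>\<sigma>\<close>.\<close>

definition cone_face :: "'a::euclidean_space set \<Rightarrow> 'a set \<Rightarrow> 'a set" where
  "cone_face C \<sigma> = {y \<in> C. \<forall>u\<in>\<sigma>. \<forall>x\<in>C. 0 \<le> inner u (x - y)}"

text \<open>
  Meant for a facet \<open>F\<close> of a full-dimensional lattice polytope \<open>\<Delta>\<close>: there the normal cone is a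
  half-line, and it contains exactly one primitive vector of the dual lattice.
\<close>

definition primitive_inner_normal :: "'a::euclidean_space set \<Rightarrow> 'a set \<Rightarrow> 'a set \<Rightarrow> 'a" where
  "primitive_inner_normal M \<Delta> F =
     (THE u. primitive_vector (dual_lattice M) u \<and> u \<in> normal_cone \<Delta> F)"

definition adjacent_polytope :: "'a::euclidean_space set \<Rightarrow> 'a set \<Rightarrow> 'a set \<Rightarrow> 'a set" where
  "adjacent_polytope M \<Delta> F =
     {x \<in> \<Delta>. \<forall>y\<in>F. inner (primitive_inner_normal M \<Delta> F) (x - y) = 1}"


section \<open>Laurent polynomials\<close>

text \<open>
  The type \<open>'a \<Rightarrow>\<^sub>0 complex\<close> with its convolution product is the group algebra of \<open>M\<^sub>\<real>\<close>, and
  \<open>\<complex>[M]\<close> is its subring of elements \<open>p\<close> with \<open>keys p \<subseteq> M\<close>. The monomial \<open>\<chi>\<^sup>m\<close> is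
  \<open>Poly_Mapping.single m 1\<close>, and \<open>keys p\<close> is the support of \<open>p\<close>.
\<close>

definition laurent_polys :: "'a::euclidean_space set \<Rightarrow> ('a \<Rightarrow>\<^sub>0 complex) set" where
  "laurent_polys M = {p. Poly_Mapping.keys p \<subseteq> M}"

definition newton_polytope :: "('a::euclidean_space \<Rightarrow>\<^sub>0 complex) \<Rightarrow> 'a set" where
  "newton_polytope p = convex hull (Poly_Mapping.keys p)"

definition restrict_supp :: "('a \<Rightarrow>\<^sub>0 complex) \<Rightarrow> 'a set \<Rightarrow> ('a \<Rightarrow>\<^sub>0 complex)" where
  "restrict_supp p S =
     (\<Sum>m \<in> Poly_Mapping.keys p \<inter> S. Poly_Mapping.single m (Poly_Mapping.lookup p m))"

definition init_part :: "'a::euclidean_space set \<Rightarrow> ('a \<Rightarrow>\<^sub>0 complex) \<Rightarrow> ('a \<Rightarrow>\<^sub>0 complex)" where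
  "init_part \<sigma> p = restrict_supp p (cone_face (newton_polytope p) \<sigma>)"


subsection \<open>The fraction field of the group algebra\<close>

text \<open>
  The library makes \<open>'a \<Rightarrow>\<^sub>0 complex\<close> an integral domain only for linearly ordered exponents.
  The type \<open>'a group_algebra\<close> is a copy of this ring that carries the \<open>idom\<close> instance for
  exponents in a Euclidean space; its only purpose is to form fractions.
\<close>

lemma exists_inner_inj_on:
  fixes S :: "'a::euclidean_space set"
  assumes "finite S"
  shows "\<exists>u. inj_on (inner u) S"
proof -
  define T where "T = (\<lambda>(x, y). {u. inner (x - y) u = 0}) ` {(x, y) \<in> S \<times> S. x \<noteq> y}"
  have "finite T"
    unfolding T_def using assms
    by (intro finite_imageI finite_subset[OF _ finite_cartesian_product[OF assms assms]]) auto
  moreover have "negligible t" if "t \<in> T" for t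
    using that unfolding T_def by (auto intro!: negligible_hyperplane)
  ultimately have "negligible (\<Union>T)" by (rule negligible_Union)
  then have "\<Union>T \<noteq> UNIV" using non_negligible_UNIV by metis
  then obtain u where u: "u \<notin> \<Union>T" by blast
  have "inj_on (inner u) S"
  proof (rule inj_onI, rule ccontr)
    fix x y assume "x \<in> S" "y \<in> S" "inner u x = inner u y" "x \<noteq> y"
    then have "u \<in> {u. inner (x - y) u = 0}" "{u. inner (x - y) u = 0} \<in> T"
      unfolding T_def by (simp add: inner_commute[of _ u] inner_diff_right, force)
    then have "u \<in> \<Union>T" by (rule UnionI[rotated])
    with u show False by simp
  qed
  then show ?thesis ..
qed

lemma group_algebra_no_zero_divisors:
  fixes f g :: "'a::euclidean_space \<Rightarrow>\<^sub>0 'b::semiring_no_zero_divisors"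
  assumes "f \<noteq> 0" "g \<noteq> 0"
  shows "f * g \<noteq> 0"
proof -
  define F where "F = Poly_Mapping.keys f"
  define G where "G = Poly_Mapping.keys g"
  have fin: "finite F" "finite G" and ne: "F \<noteq> {}" "G \<noteq> {}"
    using assms by (auto simp: F_def G_def)
  obtain u where u: "inj_on (inner u) (F \<union> G)"
    using exists_inner_inj_on[of "F \<union> G"] fin by auto
  have top: "\<exists>a\<in>H. \<forall>x\<in>H. x \<noteq> a \<longrightarrow> inner u x < inner u a"
    if "finite H" "H \<noteq> {}" "H \<subseteq> F \<union> G" for H
  proof -
    have "Max (inner u ` H) \<in> inner u ` H"
      by (rule Max_in) (use that in simp_all)
    then obtain a where a: "a \<in> H" "inner u a = Max (inner u ` H)" by fastforce
    have "inner u x < inner u a" if "x \<in> H" "x \<noteq> a" for x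
    proof -
      have "inner u x \<le> inner u a" using a that \<open>finite H\<close> by simp
      moreover have "inner u x \<noteq> inner u a"
        using inj_onD[OF u, of x a] that a \<open>H \<subseteq> F \<union> G\<close> by auto
      ultimately show ?thesis by simp
    qed
    with a show ?thesis by blast
  qed
  obtain a where a: "a \<in> F" "\<And>x. x \<in> F \<Longrightarrow> x \<noteq> a \<Longrightarrow> inner u x < inner u a"
    using top[of F] fin ne by blast
  obtain b where b: "b \<in> G" "\<And>x. x \<in> G \<Longrightarrow> x \<noteq> b \<Longrightarrow> inner u x < inner u b"
    using top[of G] fin ne by blast
  have uniq: "x = a \<and> y = b" if "x \<in> F" "y \<in> G" "a + b = x + y" for x y
  proof -
    have eq: "inner u a + inner u b = inner u x + inner u y"
      using arg_cong[OF that(3), of "inner u"] by (simp only: inner_add_right)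
    have "x = a"
    proof (rule ccontr)
      assume "x \<noteq> a"
      then have "inner u x < inner u a" by (rule a(2)[OF that(1)])
      moreover have "inner u y \<le> inner u b"
        using b(2)[OF that(2)] by (cases "y = b") (simp_all add: less_imp_le)
      ultimately show False using eq by linarith
    qed
    with that(3) show ?thesis by simp
  qed
  have lk: "Poly_Mapping.lookup (f * g) (a + b) =
      prod_fun (Poly_Mapping.lookup f) (Poly_Mapping.lookup g) (a + b)"
    by (simp add: times_poly_mapping.rep_eq)
  also have "\<dots> = (\<Sum>(x, y). Poly_Mapping.lookup f x * Poly_Mapping.lookup g y when a + b = x + y)"
    by (rule prod_fun_unfold_prod) simp_all
  also have "\<dots> = (\<Sum>xy. (case xy of (x, y) \<Rightarrow> Poly_Mapping.lookup f x * Poly_Mapping.lookup g y)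
      when (a, b) = xy)"
  proof (rule Sum_any.cong)
    fix xy :: "'a \<times> 'a"
    obtain x y where [simp]: "xy = (x, y)" by (cases xy)
    show "(case xy of (x, y) \<Rightarrow> Poly_Mapping.lookup f x * Poly_Mapping.lookup g y when a + b = x + y) =
      ((case xy of (x, y) \<Rightarrow> Poly_Mapping.lookup f x * Poly_Mapping.lookup g y) when (a, b) = xy)"
    proof (cases "x \<in> F \<and> y \<in> G")
      case True
      then have "a + b = x + y \<longleftrightarrow> (a, b) = (x, y)" using uniq[of x y] by auto
      then show ?thesis by (simp only: \<open>xy = (x, y)\<close> prod.case)
    next
      case False
      then have "Poly_Mapping.lookup f x * Poly_Mapping.lookup g y = 0"
        by (auto simp: F_def G_def in_keys_iff)
      then show ?thesis by (simp only: \<open>xy = (x, y)\<close> prod.case when_def if_cancel)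
    qed
  qed
  also have "\<dots> = Poly_Mapping.lookup f a * Poly_Mapping.lookup g b" by simp
  also have "\<dots> \<noteq> 0" using a(1) b(1) by (simp add: F_def G_def in_keys_iff)
  finally have "Poly_Mapping.lookup (f * g) (a + b) \<noteq> 0" .
  then show ?thesis by (intro notI) simp
qed

typedef 'a group_algebra = "UNIV :: ('a \<Rightarrow>\<^sub>0 complex) set" ..

setup_lifting type_definition_group_algebra

instantiation group_algebra :: (euclidean_space) idom
begin

lift_definition zero_group_algebra :: "'a group_algebra" is 0 .
lift_definition one_group_algebra :: "'a group_algebra" is 1 .
lift_definition plus_group_algebra :: "'a group_algebra \<Rightarrow> 'a group_algebra \<Rightarrow> 'a group_algebra"
  is "(+)" .
lift_definition minus_group_algebra :: "'a group_algebra \<Rightarrow> 'a group_algebra \<Rightarrow> 'a group_algebra"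
  is "(-)" .
lift_definition uminus_group_algebra :: "'a group_algebra \<Rightarrow> 'a group_algebra" is uminus .
lift_definition times_group_algebra :: "'a group_algebra \<Rightarrow> 'a group_algebra \<Rightarrow> 'a group_algebra"
  is "(*)" .

instance
proof
  fix a b c :: "'a group_algebra"
  show "a * b * c = a * (b * c)" by transfer (rule mult.assoc)
  show "a * b = b * a" by transfer (rule mult.commute)
  show "1 * a = a" by transfer (rule mult_1)
  show "a + b + c = a + (b + c)" by transfer (rule add.assoc)
  show "a + b = b + a" by transfer (rule add.commute)
  show "0 + a = a" by transfer (rule add_0)
  show "- a + a = 0" by transfer (rule left_minus)
  show "a - b = a + - b" by transfer (rule diff_conv_add_uminus)
  show "(a + b) * c = a * c + b * c" by transfer (rule distrib_right)
  show "a * (b + c) = a * b + a * c" by transfer (rule distrib_left)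
  show "0 * a = 0" by transfer (rule mult_zero_left)
  show "a * 0 = 0" by transfer (rule mult_zero_right)
  show "(0 :: 'a group_algebra) \<noteq> 1" by transfer (rule zero_neq_one)
  show "a \<noteq> 0 \<Longrightarrow> b \<noteq> 0 \<Longrightarrow> a * b \<noteq> 0"
    by transfer (rule group_algebra_no_zero_divisors)
qed

end

definition to_frac :: "('a::euclidean_space \<Rightarrow>\<^sub>0 complex) \<Rightarrow> 'a group_algebra fract" where
  "to_frac q = to_fract (Abs_group_algebra q)"


subsection \<open>The operator \<open>\<mu>\<close>\<close>

text \<open>
  For a basis \<open>B\<close> of a lattice and \<open>b \<in> B\<close>, \<open>euler_deriv B b\<close> is the operator
  \<open>y\<^sub>b \<partial>/\<partial>y\<^sub>b\<close>: it multiplies the monomial \<open>\<chi>\<^sup>m\<close>, \<open>m = (\<Sum>b\<in>B. a\<^sub>b b)\<close>, by the coordinate \<open>a\<^sub>b\<close>.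
\<close>

definition euler_deriv ::
    "'a::euclidean_space set \<Rightarrow> 'a \<Rightarrow> ('a \<Rightarrow>\<^sub>0 complex) \<Rightarrow> ('a \<Rightarrow>\<^sub>0 complex)" where
  "euler_deriv B b q = (\<Sum>m \<in> Poly_Mapping.keys q.
     Poly_Mapping.single m (complex_of_real (representation B m b) * Poly_Mapping.lookup q m))"

definition log_deriv2 ::
    "'a::euclidean_space set \<Rightarrow> 'a \<Rightarrow> 'a \<Rightarrow> ('a \<Rightarrow>\<^sub>0 complex) \<Rightarrow> 'a group_algebra fract" where
  "log_deriv2 B b c q =
     (to_frac q * to_frac (euler_deriv B b (euler_deriv B c q))
        - to_frac (euler_deriv B b q) * to_frac (euler_deriv B c q)) / to_frac q ^ 2"

text \<open>\<open>Determinant.det\<close> of the \<open>0 \<times> 0\<close> matrix is \<open>1\<close>.\<close>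

definition delta ::
    "'a::euclidean_space set \<Rightarrow> ('a \<Rightarrow>\<^sub>0 complex) \<Rightarrow> 'a group_algebra fract" where
  "delta L q = (let bs = chosen_basis L; r = lattice_rank L in
     Determinant.det (Matrix.mat r r (\<lambda>(i, j). log_deriv2 (set bs) (bs ! i) (bs ! j) q)))"

definition difference_lattice :: "'a::euclidean_space set \<Rightarrow> ('a \<Rightarrow>\<^sub>0 complex) \<Rightarrow> 'a set" where
  "difference_lattice M p =
     M \<inter> span {x - y | x y. x \<in> Poly_Mapping.keys p \<and> y \<in> Poly_Mapping.keys p}"

text \<open>
  The equation for \<open>g\<close> lives in the fraction field, in which the ring embeds, so \<open>g\<close> is unique.
  The choice of \<open>m0\<close> in the support is immaterial.
\<close>

definition mu :: "'a::euclidean_space set \<Rightarrow> ('a \<Rightarrow>\<^sub>0 complex) \<Rightarrow> ('a \<Rightarrow>\<^sub>0 complex)" where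
  "mu M p = (let L = difference_lattice M p; r = lattice_rank L;
                 m0 = (SOME m. m \<in> Poly_Mapping.keys p)
     in THE g. g \<in> laurent_polys M \<and>
          to_frac g = to_frac p ^ (r + 1) * delta L (Poly_Mapping.single (- m0) 1 * p))"

end

theory Submission
  imports Defs
begin

text \<open>
  Clearing denominators turns \<open>\<mu>\<close> into a single determinant. With \<open>\<phi>\<^sub>0 = 1\<close> and \<open>\<phi>\<^sub>1, \<dots>, \<phi>\<^sub>r\<close> the
  coordinates on the affine lattice through the support, a Schur complement shows that \<open>\<mu>(p)\<close> is
  the determinant of the \<open>(r + 1) \<times> (r + 1)\<close> matrix with entries
  \<open>\<Sum>\<^sub>m \<phi>\<^sub>i(m) \<phi>\<^sub>j(m) c\<^sub>m \<chi>\<^sup>m\<close> (called \<open>gram\<close> below). An affine change of coordinates multiplies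
  this matrix by a unimodular integer matrix on both sides, so neither the chosen basis nor the
  chosen origin matters (\<open>mu_eq_det_gram\<close>).

  Let \<open>u\<close> be the primitive inner normal of the facet, and let \<open>h\<close> be its value there, so that \<open>u\<close>
  takes values in \<open>{h, h + 1, \<dots>}\<close> on the support. Take coordinates whose last one is \<open>u - h\<close>. The
  last row and the last column of the matrix then only involve monomials of level at least
  \<open>h + 1\<close>, the other entries monomials of level at least \<open>h\<close>. The part of the determinant in the
  lowest possible level is therefore the determinant of the lowest parts of the entries, with the
  lowest level counted row by row. This matrix is block triangular: its blocks are the matrix of
  the initial part of \<open>p\<close> and the \<open>1 \<times> 1\<close> block made of the level \<open>h + 1\<close> part of \<open>p\<close>, which is the
  restriction of \<open>p\<close> to the adjacent polytope. This is the product formula (\<open>gram_level\<close>).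

  This lowest part is the initial part of \<open>\<mu>(p)\<close> only if it does not vanish. Here unimodularity enters: at a
  vertex \<open>v\<close> of the facet there is a lattice basis \<open>B\<close> such that \<open>v + b\<close> is in the support for every
  \<open>b\<close> in \<open>B\<close> and the polytope lies in \<open>v\<close> plus the cone of \<open>B\<close>. The second property holds because
  a polytope lies in the cone spanned by its edges at a vertex (\<open>polytope_in_cone_of_edges\<close>). Peeling
  off one coordinate after the other with the product formula, and using that the group algebra
  has no zero divisors, the determinant is nonzero (\<open>det_gram_nonzero\<close>). The same basis shows that
  the ray \<open>\<tau>\<close> is spanned by a member \<open>u\<close> of the dual basis of \<open>B\<close> (\<open>normal_fan_ray\<close>).
\<close>

section \<open>The cone of a polytope at a vertex\<close>

text \<open>
  The vertex figure: a functional that is maximal exactly at \<open>v\<close> allows the vectors \<open>s - v\<close> to be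
  rescaled onto a hyperplane that misses the origin. An extreme point \<open>q\<close> of the convex hull of the
  rescaled vectors is exposed, and an exposing functional, pulled back to the cone over this slice,
  exposes an edge of the polytope in direction \<open>q\<close>. The slice is the convex hull of its extreme
  points.
\<close>

lemma polytope_in_cone_of_edges:
  fixes S :: "'a::euclidean_space set"
  assumes fin: "finite S" and v: "v extreme_point_of (convex hull S)"
    and C: "convex C" "cone C" "0 \<in> C"
    and edge: "\<And>E. E edge_of (convex hull S) \<Longrightarrow> v \<in> E \<Longrightarrow> \<exists>w\<in>E. w \<noteq> v \<and> w - v \<in> C"
    and x: "x \<in> convex hull S"
  shows "x - v \<in> C"
proof -
  let ?P = "convex hull S"
  have polyS: "polyhedron ?P"
    by (simp add: fin polyhedron_convex_hull)
  have vP: "v \<in> ?P" using v by (simp add: extreme_point_of_def)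
  obtain l c where l: "?P \<subseteq> {x. inner l x \<le> c}" "{v} = ?P \<inter> {x. inner l x = c}"
    using exposed_face_of_polyhedron[OF polyS, of "{v}"] v
    unfolding exposed_face_of_def by (auto simp: face_of_singleton)
  have lv: "inner l v = c" using l(2) by blast
  define h where "h y = inner l (v - y)" for y
  have hpos: "h s > 0" if "s \<in> S" "s \<noteq> v" for s
  proof -
    have "s \<in> ?P" using that hull_inc by metis
    then have "inner l s \<le> c" "inner l s \<noteq> c" using l that by auto
    then show ?thesis by (simp add: h_def inner_diff_right lv)
  qed
  \<comment> \<open>\<open>g\<close> rescales the directions to points of the slice \<open>- l = 1\<close> of the cone at \<open>v\<close>.\<close>
  define g where "g s = (1 / h s) *\<^sub>R (s - v)" for s
  define T where "T = g ` (S - {v})"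
  have finT: "finite T" by (simp add: T_def fin)
  have hg: "inner (- l) t = 1" if tT: "t \<in> T" for t
  proof -
    obtain s where s: "s \<in> S" "s \<noteq> v" "t = g s" using tT by (auto simp: T_def)
    have "inner (- l) t = (1 / h s) * h s"
      unfolding s(3) g_def h_def by (simp only: inner_scaleR_right) (simp add: inner_diff_right)
    then show ?thesis using hpos[OF s(1,2)] by simp
  qed
  have polyT: "polyhedron (convex hull T)" by (simp add: finT polyhedron_convex_hull)
  \<comment> \<open>An extreme point \<open>q\<close> of the slice is the direction of an edge at \<open>v\<close>.\<close>
  have ext: "q \<in> C" if q: "q extreme_point_of (convex hull T)" for q
  proof -
    have qT: "q \<in> T" using extreme_point_of_convex_hull[OF q] .
    then obtain s where s: "s \<in> S" "s \<noteq> v" "q = g s" by (auto simp: T_def)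
    obtain k d where k: "convex hull T \<subseteq> {x. inner k x \<le> d}"
        "{q} = convex hull T \<inter> {x. inner k x = d}"
      using exposed_face_of_polyhedron[OF polyT, of "{q}"] q
      unfolding exposed_face_of_def by (auto simp: face_of_singleton)
    \<comment> \<open>The linear functional that agrees with \<open>k - d\<close> on the slice, where \<open>- l\<close> equals \<open>1\<close>.\<close>
    define f where "f = k + d *\<^sub>R l"
    have fg: "inner f (y - v) = h y * (inner k (g y) - d)" if "y \<in> S" "y \<noteq> v" for y
    proof -
      have "inner l (y - v) = - h y" by (simp add: h_def inner_diff_right)
      moreover have "inner k (y - v) = h y * inner k (g y)"
        using hpos[OF that] by (simp add: g_def)
      ultimately show ?thesis by (simp add: f_def inner_add_left right_diff_distrib)
    qed
    have fle: "inner f (y - v) \<le> 0" if "y \<in> S" for y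
    proof (cases "y = v")
      case False
      then have "g y \<in> convex hull T" using that by (simp add: T_def hull_inc)
      then have "inner k (g y) \<le> d" using k(1) by auto
      then show ?thesis
        using hpos[OF that False] by (simp add: fg[OF that False] mult_nonneg_nonpos)
    qed simp
    have feq: "\<exists>a. y - v = a *\<^sub>R q" if "y \<in> S" "inner f (y - v) = 0" for y
    proof (cases "y = v")
      case True then show ?thesis by (intro exI[of _ 0]) simp
    next
      case False
      then have "g y \<in> convex hull T" using that by (simp add: T_def hull_inc)
      moreover have "inner k (g y) = d" using that hpos[OF that(1) False] by (simp add: fg[OF that(1) False])
      ultimately have "g y = q" using k(2) by blast
      then show ?thesis using hpos[OF that(1) False]
        by (intro exI[of _ "h y"]) (auto simp: g_def)
    qed
    define b where "b = inner f v"
    have PH: "?P \<subseteq> {x. inner f x \<le> b}"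
      by (rule hull_minimal) (use fle in \<open>auto simp: b_def inner_diff_right convex_halfspace_le\<close>)
    define E where "E = ?P \<inter> {x. inner f x = b}"
    have face: "E face_of ?P"
      unfolding E_def by (rule face_of_Int_supporting_hyperplane_le) (use PH in auto)
    have Ehull: "E = convex hull (S \<inter> {x. inner f x = b})"
    proof -
      obtain S' where S': "S' \<subseteq> S" "E = convex hull S'"
        using face_of_convex_hull_subset[OF finite_imp_compact[OF fin] face] by blast
      have "S' \<subseteq> E" unfolding S'(2) by (rule hull_subset)
      then have "S' \<subseteq> S \<inter> {x. inner f x = b}" using S' by (auto simp: E_def)
      then have "E \<subseteq> convex hull (S \<inter> {x. inner f x = b})" unfolding S'(2) by (rule hull_mono)
      moreover have "convex hull (S \<inter> {x. inner f x = b}) \<subseteq> E"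
      proof (rule hull_minimal)
        show "S \<inter> {x. inner f x = b} \<subseteq> E" using hull_subset[of S convex] by (auto simp: E_def)
        show "convex E" using face face_of_imp_convex by blast
      qed
      ultimately show ?thesis by blast
    qed
    have line: "\<exists>a. y = v + a *\<^sub>R q" if "y \<in> E" for y
    proof -
      have "convex hull (S \<inter> {x. inner f x = b}) \<subseteq> range (\<lambda>a. v + a *\<^sub>R q)"
      proof (rule hull_minimal)
        show "S \<inter> {x. inner f x = b} \<subseteq> range (\<lambda>a. v + a *\<^sub>R q)"
          using feq by (auto simp: b_def inner_diff_right algebra_simps image_iff)
        have "range (\<lambda>a. v + a *\<^sub>R q) = (+) v ` (span {q})" by (auto simp: span_singleton)
        then show "convex (range (\<lambda>a. v + a *\<^sub>R q))" by (simp add: convex_translation subspace_imp_convex)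
      qed
      then show ?thesis using that Ehull by auto
    qed
    have vE: "v \<in> E" using vP by (simp add: E_def b_def)
    have "inner k q = d" using k(2) by blast
    then have "inner f s = b" using fg[OF s(1,2)] s(3) by (simp add: b_def inner_diff_right)
    then have sE: "s \<in> E" using s(1) hull_inc by (fastforce simp: E_def)
    have "aff_dim E = 1"
    proof -
      have "aff_dim E = int (dim ((\<lambda>x. x - v) ` E))"
        using aff_dim_eq_dim_subtract[of v E] hull_inc[OF vE] by simp
      moreover have "(\<lambda>x. x - v) ` E \<subseteq> span {q}"
      proof
        fix z assume "z \<in> (\<lambda>x. x - v) ` E"
        then obtain y where "y \<in> E" "z = y - v" by auto
        then show "z \<in> span {q}" using line[of y] by (auto simp: span_singleton)
      qed
      then have "dim ((\<lambda>x. x - v) ` E) \<le> 1"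
        using dim_le_card[of "(\<lambda>x. x - v) ` E" "{q}"] by simp
      moreover have "dim ((\<lambda>x. x - v) ` E) \<noteq> 0"
      proof
        assume "dim ((\<lambda>x. x - v) ` E) = 0"
        then have "(\<lambda>x. x - v) ` E \<subseteq> {0}" by (simp only: dim_eq_0)
        then show False using s(2) sE by auto
      qed
      ultimately show ?thesis by linarith
    qed
    then have "E edge_of ?P" using face by (simp add: edge_of_def)
    then obtain w where w: "w \<in> E" "w \<noteq> v" "w - v \<in> C" using edge vE by blast
    obtain a where a: "w = v + a *\<^sub>R q" using line w(1) by blast
    have "inner l w \<le> c" using w(1) l(1) by (auto simp: E_def)
    moreover have "inner l w = c - a" using a hg[OF qT] lv by (simp add: inner_add_right)
    ultimately have "a > 0" using a w(2) by (cases "a = 0") auto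
    moreover have "q = (1 / a) *\<^sub>R (w - v)" using a \<open>a > 0\<close> by simp
    ultimately show "q \<in> C" using C(2) w(3) unfolding cone_def
      by (metis less_imp_le zero_le_divide_1_iff)
  qed
  have "convex hull T = convex hull {q. q extreme_point_of (convex hull T)}"
    by (intro Krein_Milman_Minkowski finite_imp_compact_convex_hull finT convex_convex_hull)
  also have "\<dots> \<subseteq> C" by (rule hull_minimal) (use ext C in auto)
  finally have TC: "T \<subseteq> C" using hull_subset[of T convex] by blast
  have "S \<subseteq> (+) v ` C"
  proof
    fix s assume s: "s \<in> S"
    have "s - v \<in> C"
    proof (cases "s = v")
      case False
      then have "g s \<in> C" using TC s by (auto simp: T_def)
      moreover have "s - v = h s *\<^sub>R g s" using hpos[OF s False] by (simp add: g_def)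
      ultimately show ?thesis using C(2) hpos[OF s False] unfolding cone_def by (metis less_imp_le)
    qed (simp add: C)
    then show "s \<in> (+) v ` C" by (metis add.commute diff_add_cancel image_eqI)
  qed
  then have "?P \<subseteq> (+) v ` C" by (rule hull_minimal) (simp add: C convex_translation)
  then show ?thesis using x by auto
qed

section \<open>Lattice bases\<close>

lemma int_span_subset_span: "int_span B \<subseteq> span B"
  by (auto simp: int_span_def intro!: span_sum span_scale intro: span_base)

lemma int_spanI: "x = (\<Sum>b\<in>B. of_int (c b) *\<^sub>R b) \<Longrightarrow> x \<in> int_span B"
  unfolding int_span_def mem_Collect_eq by (rule exI[of _ c])

lemma base_in_int_span:
  assumes "finite B" "b \<in> B" shows "b \<in> int_span B"
proof -
  have "(\<Sum>c\<in>B. of_int (if c = b then 1 else 0) *\<^sub>R c) = (\<Sum>c\<in>B. if c = b then c else 0)"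
    by (intro sum.cong) auto
  also have "\<dots> = b" using assms by simp
  finally show ?thesis by (rule int_spanI[OF sym])
qed

lemma lattice_basis_subset: "lattice_basis B L \<Longrightarrow> B \<subseteq> L"
  using base_in_int_span[of B] by (auto simp: lattice_basis_def independent_imp_finite)

lemma lattice_basis_span:
  assumes "lattice_basis B L" shows "span B = span L"
proof
  show "span B \<subseteq> span L" using lattice_basis_subset[OF assms] by (rule span_mono)
  show "span L \<subseteq> span B"
    by (rule span_minimal) (use assms int_span_subset_span in \<open>auto simp: lattice_basis_def\<close>)
qed

lemma int_span_0: "0 \<in> int_span B"
  unfolding int_span_def by (auto intro!: exI[of _ "\<lambda>_. 0"])

lemma int_span_add: "x \<in> int_span B \<Longrightarrow> y \<in> int_span B \<Longrightarrow> x + y \<in> int_span B"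
proof -
  assume "x \<in> int_span B" "y \<in> int_span B"
  then obtain c d where "x = (\<Sum>b\<in>B. of_int (c b) *\<^sub>R b)" "y = (\<Sum>b\<in>B. of_int (d b) *\<^sub>R b)"
    by (auto simp: int_span_def)
  then have "x + y = (\<Sum>b\<in>B. of_int (c b + d b) *\<^sub>R b)" by (simp add: sum.distrib scaleR_add_left)
  then show ?thesis by (rule int_spanI)
qed

lemma int_span_uminus: "x \<in> int_span B \<Longrightarrow> - x \<in> int_span B"
proof -
  assume "x \<in> int_span B"
  then obtain c where "x = (\<Sum>b\<in>B. of_int (c b) *\<^sub>R b)" by (auto simp: int_span_def)
  then have "- x = (\<Sum>b\<in>B. of_int (- c b) *\<^sub>R b)" by (simp add: sum_negf)
  then show ?thesis by (rule int_spanI)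
qed

lemma int_span_diff: "x \<in> int_span B \<Longrightarrow> y \<in> int_span B \<Longrightarrow> x - y \<in> int_span B"
  using int_span_add[of x B "- y"] int_span_uminus[of y B] by simp

lemma representation_int_span:
  assumes ind: "independent B" and x: "x \<in> int_span (B :: 'a::euclidean_space set)"
  shows "representation B x b \<in> \<int>"
proof -
  have fin: "finite B" using ind independent_imp_finite by blast
  obtain c :: "'a \<Rightarrow> int" where c: "x = (\<Sum>b\<in>B. of_int (c b) *\<^sub>R b)"
    using x by (auto simp: int_span_def)
  have "representation B x = (\<lambda>b. if b \<in> B then of_int (c b) else 0)"
  proof (rule representation_eqI[OF ind])
    show "x \<in> span B" using x int_span_subset_span by blast
    have *: "{b. (if b \<in> B then of_int (c b) else 0 :: real) \<noteq> 0} \<subseteq> B" by auto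
    show "finite {b. (if b \<in> B then of_int (c b) else 0 :: real) \<noteq> 0}" using * fin finite_subset by blast
    have "(\<Sum>b | (if b \<in> B then of_int (c b) else 0 :: real) \<noteq> 0. (if b \<in> B then of_int (c b) else 0) *\<^sub>R b)
        = (\<Sum>b\<in>B. of_int (c b) *\<^sub>R b)"
      using fin by (intro sum.mono_neutral_cong_left) auto
    then show "(\<Sum>b | (if b \<in> B then of_int (c b) else 0 :: real) \<noteq> 0. (if b \<in> B then of_int (c b) else 0) *\<^sub>R b) = x"
      by (simp add: c)
  qed (auto split: if_splits)
  then show ?thesis by simp
qed

lemma int_span_iff_representation:
  assumes ind: "independent (B :: 'a::euclidean_space set)"
  shows "x \<in> int_span B \<longleftrightarrow> x \<in> span B \<and> (\<forall>b\<in>B. representation B x b \<in> \<int>)"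
proof (intro iffI conjI ballI)
  assume "x \<in> span B \<and> (\<forall>b\<in>B. representation B x b \<in> \<int>)"
  then have x: "x \<in> span B" and r: "\<forall>b\<in>B. representation B x b \<in> \<int>" by auto
  have "x = (\<Sum>b\<in>B. representation B x b *\<^sub>R b)"
    using sum_representation_eq[OF ind x independent_imp_finite[OF ind]] by simp
  also have "\<dots> = (\<Sum>b\<in>B. of_int \<lfloor>representation B x b\<rfloor> *\<^sub>R b)"
    by (rule sum.cong) (use r in auto)
  finally show "x \<in> int_span B" by (auto simp: int_span_def)
qed (use int_span_subset_span representation_int_span[OF ind] in blast)+

lemma representation_change:
  fixes B C :: "'a::euclidean_space set"
  assumes "independent B" "independent C" "x \<in> span C" "span C \<subseteq> span B"
  shows "representation B x b = (\<Sum>c\<in>C. representation C x c * representation B c b)"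
proof -
  have C: "C \<subseteq> span B" using assms(4) span_superset by blast
  have "representation B x b = representation B (\<Sum>c\<in>C. representation C x c *\<^sub>R c) b"
    using sum_representation_eq[OF assms(2,3) independent_imp_finite[OF assms(2)]] by simp
  also have "\<dots> = (\<Sum>c\<in>C. representation B (representation C x c *\<^sub>R c) b)"
    by (subst representation_sum[OF assms(1)]) (use C in \<open>auto intro: span_scale\<close>)
  also have "\<dots> = (\<Sum>c\<in>C. representation C x c * representation B c b)"
    by (intro sum.cong refl) (use C in \<open>auto simp: representation_scale[OF assms(1)]\<close>)
  finally show ?thesis .
qed

lemma sum_set_nth: "distinct cs \<Longrightarrow> (\<Sum>c\<in>set cs. f c) = (\<Sum>j<length cs. f (cs ! j))"
  using sum.reindex_bij_betw[OF bij_betw_nth[OF _ refl refl, of cs], of f] by simp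

lemma span_delete:
  fixes B :: "'a::euclidean_space set"
  assumes "independent B" "x \<in> span B" "representation B x b0 = 0"
  shows "x \<in> span (B - {b0})"
proof -
  have "x = (\<Sum>b\<in>B. representation B x b *\<^sub>R b)"
    using sum_representation_eq[OF assms(1,2) independent_imp_finite[OF assms(1)]] by simp
  also have "\<dots> = (\<Sum>b\<in>B - {b0}. representation B x b *\<^sub>R b)"
    using independent_imp_finite[OF assms(1)] assms(3) by (intro sum.mono_neutral_right) auto
  finally show ?thesis
    by (metis (no_types, lifting) span_base span_scale span_sum)
qed

text \<open>
  Part of a lattice basis is a basis of the saturated sublattice that it spans. This supplies a
  basis of the lattice of the initial part of a Laurent polynomial.
\<close>

lemma lattice_basis_Int_span:
  fixes B :: "'a::euclidean_space set"
  assumes B: "lattice_basis B M" and sub: "C \<subseteq> B" and V: "span D = span C"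
  shows "lattice_basis C (M \<inter> span D)"
proof -
  have ind: "independent B" and M: "M = int_span B" using B by (auto simp: lattice_basis_def)
  have indC: "independent C" using ind sub by (rule independent_mono)
  have rep: "representation B x = representation C x" if "x \<in> span C" for x
    by (rule representation_extend[OF ind that sub])
  have "x \<in> M \<inter> span D \<longleftrightarrow> x \<in> int_span C" for x
  proof
    assume "x \<in> M \<inter> span D"
    then have "x \<in> span C" "\<forall>b\<in>B. representation B x b \<in> \<int>"
      using V by (auto simp: M int_span_iff_representation[OF ind])
    then show "x \<in> int_span C"
      using sub rep by (auto simp: int_span_iff_representation[OF indC])
  next
    assume "x \<in> int_span C"
    then have x: "x \<in> span C" and r: "\<forall>b\<in>C. representation C x b \<in> \<int>"
      by (auto simp: int_span_iff_representation[OF indC])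
    have "representation C x b \<in> \<int>" for b
      using r representation_ne_zero[of C x b] by (cases "b \<in> C") (auto, metis Ints_0)
    moreover have "x \<in> span B" using x span_mono[OF sub] by blast
    ultimately show "x \<in> M \<inter> span D"
      using x V by (simp add: M int_span_iff_representation[OF ind] rep)
  qed
  then show ?thesis using indC by (auto simp: lattice_basis_def)
qed

definition dual_vec :: "'a::euclidean_space set \<Rightarrow> 'a \<Rightarrow> 'a" where
  "dual_vec B b = (\<Sum>e\<in>Basis. representation B e b *\<^sub>R e)"

lemma inner_dual_vec:
  fixes B :: "'a::euclidean_space set"
  assumes "independent B" "span B = UNIV"
  shows "inner (dual_vec B b) x = representation B x b"
proof -
  have "representation B x b = representation B (\<Sum>e\<in>Basis. inner x e *\<^sub>R e) b"
    by (simp add: euclidean_representation)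
  also have "\<dots> = (\<Sum>e\<in>Basis. representation B (inner x e *\<^sub>R e) b)"
    by (subst representation_sum[OF assms(1)]) (simp_all add: assms(2))
  also have "\<dots> = (\<Sum>e\<in>Basis. inner x e * representation B e b)"
    by (intro sum.cong refl) (simp add: representation_scale[OF assms(1)] assms(2))
  finally show ?thesis
    by (simp add: dual_vec_def inner_sum_left) (simp add: inner_commute mult.commute)
qed

lemma inner_eq_sum_representation:
  fixes B :: "'a::euclidean_space set"
  assumes "independent B" "span B = UNIV"
  shows "inner z x = (\<Sum>b\<in>B. representation B x b * inner z b)"
proof -
  have "inner z x = inner z (\<Sum>b\<in>B. representation B x b *\<^sub>R b)"
    using sum_representation_eq[OF assms(1), of x] assms independent_imp_finite[OF assms(1)] by simp
  then show ?thesis by (simp add: inner_sum_right)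
qed

lemma det_in_Ints:
  fixes A :: "complex mat"
  assumes "A \<in> carrier_mat k k" "\<And>i j. i < k \<Longrightarrow> j < k \<Longrightarrow> A $$ (i, j) \<in> \<int>"
  shows "Determinant.det A \<in> \<int>"
proof -
  have "signof \<pi> * (\<Prod>i = 0..<k. A $$ (i, \<pi> i)) \<in> \<int>" if "\<pi> permutes {0..<k}" for \<pi>
  proof -
    have "(\<Prod>i = 0..<k. A $$ (i, \<pi> i)) \<in> \<int>"
      using permutes_in_image[OF that] assms(2) by (intro Ints_prod) auto
    then show ?thesis by (cases \<pi> rule: sign_cases) auto
  qed
  then show ?thesis unfolding det_def'[OF assms(1)] by (intro Ints_sum) auto
qed

text \<open>
  The two transition matrices are integral and inverse to each other, so their determinants are
  integers with product \<open>1\<close>.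
\<close>

lemma det_lattice_basis_change:
  fixes bs cs :: "'a::euclidean_space list"
  assumes bs: "distinct bs" "lattice_basis (set bs) L"
    and cs: "distinct cs" "lattice_basis (set cs) L"
  shows "length bs = length cs"
    and "Determinant.det (Matrix.mat (length cs) (length cs)
      (\<lambda>(i, j). complex_of_real (representation (set bs) (cs ! j) (bs ! i)))) ^ 2 = 1"
proof -
  let ?n = "length cs"
  have ind: "independent (set bs)" "independent (set cs)"
    and L: "L = int_span (set bs)" "L = int_span (set cs)"
    using assms by (auto simp: lattice_basis_def)
  have in_L: "set bs \<subseteq> L" "set cs \<subseteq> L"
    using assms lattice_basis_subset by auto
  have sp: "span (set bs) = span (set cs)"
    using lattice_basis_span[OF bs(2)] lattice_basis_span[OF cs(2)] by simp
  show len: "length bs = ?n"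
    using sp ind bs(1) cs(1) by (metis dim_eq_card distinct_card)
  let ?A = "\<lambda>bs cs. Matrix.mat ?n ?n (\<lambda>(i, j). complex_of_real (representation (set bs) (cs ! j) (bs ! i)))"
  have int: "Determinant.det (?A bs cs) \<in> \<int>" "Determinant.det (?A cs bs) \<in> \<int>"
  proof -
    have "of_real x \<in> (\<int> :: complex set)" if "x \<in> \<int>" for x using that by (auto elim!: Ints_cases)
    then show "Determinant.det (?A bs cs) \<in> \<int>" "Determinant.det (?A cs bs) \<in> \<int>"
      using in_L L representation_int_span[OF ind(1)] representation_int_span[OF ind(2)] len
      by (auto intro!: det_in_Ints[of _ ?n] simp: subset_eq)
  qed
  have "?A bs cs * ?A cs bs = 1\<^sub>m ?n"
  proof (rule eq_matI)
    fix i j assume "i < dim_row (1\<^sub>m ?n :: complex mat)" "j < dim_col (1\<^sub>m ?n :: complex mat)"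
    then have ij: "i < ?n" "j < ?n" by auto
    have bj: "bs ! j \<in> span (set cs)" using ij len sp by (metis nth_mem span_base)
    have "(?A bs cs * ?A cs bs) $$ (i, j) = complex_of_real
        (\<Sum>k<?n. representation (set cs) (bs ! j) (cs ! k) * representation (set bs) (cs ! k) (bs ! i))"
      using ij by (simp add: scalar_prod_def atLeast0LessThan mult.commute)
    also have "\<dots> = complex_of_real (representation (set bs) (bs ! j) (bs ! i))"
      using representation_change[OF ind bj, of "bs ! i"] sp by (simp add: sum_set_nth[OF cs(1)])
    also have "\<dots> = (1\<^sub>m ?n) $$ (i, j)"
      using ij len bs(1) representation_basis[OF ind(1), of "bs ! j"]
      by (auto simp: nth_eq_iff_index_eq)
    finally show "(?A bs cs * ?A cs bs) $$ (i, j) = (1\<^sub>m ?n) $$ (i, j)" .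
  qed simp_all
  then have "Determinant.det (?A bs cs) * Determinant.det (?A cs bs) = 1"
    using det_mult[of "?A bs cs" ?n "?A cs bs"] by simp
  then obtain a b :: int where ab: "Determinant.det (?A bs cs) = of_int a" "a * b = 1"
    using int by (elim Ints_cases) (metis of_int_1 of_int_eq_iff of_int_mult)
  then have "a^2 = 1" by (auto simp: zmult_eq_1_iff)
  then show "Determinant.det (?A bs cs) ^ 2 = 1"
    unfolding ab(1) by (metis of_int_1 of_int_power)
qed

section \<open>Weighted Laurent polynomials and their Gram determinants\<close>

abbreviation lookup where "lookup \<equiv> Poly_Mapping.lookup"
abbreviation keys where "keys \<equiv> Poly_Mapping.keys"

lemma lookup_sum_single:
  assumes "finite A"
  shows "lookup (\<Sum>m\<in>A. Poly_Mapping.single m (f m)) x = (if x \<in> A then f x else 0)"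
  using assms by (simp add: lookup_sum lookup_single when_def)

text \<open>
  The diagonal operators on the group algebra; the operators \<open>y\<^sub>i \<partial>/\<partial>y\<^sub>i\<close> and all their products are
  of this form.
\<close>

definition weight :: "('a \<Rightarrow> complex) \<Rightarrow> ('a \<Rightarrow>\<^sub>0 complex) \<Rightarrow> ('a \<Rightarrow>\<^sub>0 complex)" where
  "weight \<phi> p = (\<Sum>m\<in>keys p. Poly_Mapping.single m (\<phi> m * lookup p m))"

lemma lookup_weight [simp]: "lookup (weight \<phi> p) m = \<phi> m * lookup p m"
  by (auto simp: weight_def lookup_sum_single in_keys_iff)

lemma keys_weight: "keys (weight \<phi> p) \<subseteq> keys p"
  by (auto simp: in_keys_iff)

lemma euler_deriv_eq_weight:
  "euler_deriv B b = weight (\<lambda>m. complex_of_real (representation B m b))"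
  by (rule ext) (simp add: euler_deriv_def weight_def)

lemma weight_weight: "weight \<phi> (weight \<psi> p) = weight (\<lambda>m. \<phi> m * \<psi> m) p"
  by (rule poly_mapping_eqI) (simp add: mult.assoc)

lemma weight_cong: "(\<And>m. m \<in> keys p \<Longrightarrow> \<phi> m = \<psi> m) \<Longrightarrow> weight \<phi> p = weight \<psi> p"
  unfolding weight_def by (intro sum.cong) simp_all

lemma weight_one [simp]: "weight (\<lambda>_. 1) p = p"
  by (rule poly_mapping_eqI) simp

lemma lookup_monom_mult:
  fixes p :: "'a::ab_group_add \<Rightarrow>\<^sub>0 complex"
  shows "lookup (Poly_Mapping.single a c * p) m = c * lookup p (m - a)"
proof -
  have "lookup (Poly_Mapping.single a c * p) m =
      (\<Sum>k. lookup (Poly_Mapping.single a c) k * (\<Sum>q. lookup p q when m = k + q))"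
    by (rule lookup_mult)
  also have "\<dots> = (\<Sum>k. (c * (\<Sum>q. lookup p q when m = k + q)) when a = k)"
    by (rule Sum_any.cong) (simp add: lookup_single when_def)
  also have "\<dots> = c * (\<Sum>q. lookup p q when m = a + q)" by simp
  also have "(\<Sum>q. lookup p q when m = a + q) = (\<Sum>q. lookup p q when m - a = q)"
    by (rule Sum_any.cong) (auto simp: when_def algebra_simps)
  finally show ?thesis by simp
qed

lemma lookup_mult_const:
  fixes p :: "'a::ab_group_add \<Rightarrow>\<^sub>0 complex"
  shows "lookup (p * Poly_Mapping.single 0 c) m = lookup p m * c"
  using lookup_monom_mult[of 0 c p m] by (simp add: mult.commute)

lemma weight_monom_mult:
  fixes p :: "'a::ab_group_add \<Rightarrow>\<^sub>0 complex"
  shows "weight \<phi> (Poly_Mapping.single a c * p) = Poly_Mapping.single a c * weight (\<lambda>m. \<phi> (a + m)) p"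
  by (rule poly_mapping_eqI) (simp add: lookup_monom_mult)

text \<open>
  The Gram matrix of the functions \<open>\<phi>\<^sub>i\<close> on the support of \<open>p\<close> for the bilinear form with weight
  \<open>c\<^sub>m \<chi>\<^sup>m\<close> at \<open>m\<close>. As \<open>\<phi>\<close> is not tied to a basis, one notion serves for all lattices, origins and
  subsets of coordinates.
\<close>

definition gram :: "nat \<Rightarrow> (nat \<Rightarrow> 'a \<Rightarrow> complex) \<Rightarrow> ('a::euclidean_space \<Rightarrow>\<^sub>0 complex) \<Rightarrow> ('a \<Rightarrow>\<^sub>0 complex) mat"
  where "gram k \<phi> p = Matrix.mat k k (\<lambda>(i, j). weight (\<lambda>m. \<phi> i m * \<phi> j m) p)"

lemma gram_carrier [simp]: "gram k \<phi> p \<in> carrier_mat k k"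
  by (simp add: gram_def)

lemma gram_index [simp]:
  "i < k \<Longrightarrow> j < k \<Longrightarrow> gram k \<phi> p $$ (i, j) = weight (\<lambda>m. \<phi> i m * \<phi> j m) p"
  by (simp add: gram_def)

lemma gram_dim [simp]: "dim_row (gram k \<phi> p) = k" "dim_col (gram k \<phi> p) = k"
  by (simp_all add: gram_def)

lemma gram_cong:
  assumes "\<And>i m. i < k \<Longrightarrow> m \<in> keys p \<Longrightarrow> \<phi> i m = \<psi> i m"
  shows "gram k \<phi> p = gram k \<psi> p"
  by (rule eq_matI) (auto simp: assms intro!: weight_cong)

lemma comm_ring_hom_const:
  "comm_ring_hom (Poly_Mapping.single 0 :: complex \<Rightarrow> 'a::comm_monoid_add \<Rightarrow>\<^sub>0 complex)"
  by unfold_locales (simp_all add: single_add mult_single)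

text \<open>
  \<open>gram k \<psi> p = A * gram k \<phi> p * A\<^sup>T\<close>, where the constants in \<open>A\<close> are multiples of \<open>\<chi>\<^sup>0\<close>.
\<close>

lemma det_gram_linear_change:
  fixes p :: "'a::euclidean_space \<Rightarrow>\<^sub>0 complex"
  assumes A: "A \<in> carrier_mat k k"
    and \<psi>: "\<And>i m. i < k \<Longrightarrow> m \<in> keys p \<Longrightarrow> \<psi> i m = (\<Sum>j<k. A $$ (i, j) * \<phi> j m)"
  shows "Determinant.det (gram k \<psi> p) =
    Poly_Mapping.single 0 (Determinant.det A ^ 2) * Determinant.det (gram k \<phi> p)"
proof -
  interpret const: comm_ring_hom "Poly_Mapping.single 0 :: complex \<Rightarrow> 'a \<Rightarrow>\<^sub>0 complex"
    by (rule comm_ring_hom_const)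
  let ?h = "Poly_Mapping.single 0 :: complex \<Rightarrow> 'a \<Rightarrow>\<^sub>0 complex"
  let ?A = "map_mat ?h A"
  let ?G = "gram k \<phi> p"
  have A': "?A \<in> carrier_mat k k" and T: "transpose_mat ?A \<in> carrier_mat k k" using A by auto
  have "gram k \<psi> p = ?A * ?G * transpose_mat ?A"
  proof (rule eq_matI)
    fix i j assume "i < dim_row (?A * ?G * transpose_mat ?A)" "j < dim_col (?A * ?G * transpose_mat ?A)"
    then have ij: "i < k" "j < k" using A by auto
    have "(?A * ?G * transpose_mat ?A) $$ (i, j) =
        (\<Sum>b<k. (\<Sum>a<k. ?h (A $$ (i, a)) * ?G $$ (a, b)) * ?h (A $$ (j, b)))"
      using ij A by (simp add: scalar_prod_def atLeast0LessThan)
    also have "\<dots> = gram k \<psi> p $$ (i, j)"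
    proof (rule poly_mapping_eqI)
      fix m
      let ?c = "lookup p m"
      have "lookup (\<Sum>b<k. (\<Sum>a<k. ?h (A $$ (i, a)) * ?G $$ (a, b)) * ?h (A $$ (j, b))) m =
          (\<Sum>b<k. (\<Sum>a<k. A $$ (i, a) * (\<phi> a m * \<phi> b m * ?c)) * A $$ (j, b))"
        unfolding lookup_sum lookup_mult_const lookup_monom_mult by (intro sum.cong refl arg_cong2[of _ _ _ _ "(*)"]) simp_all
      also have "\<dots> = (\<Sum>b<k. (\<Sum>a<k. A $$ (i, a) * \<phi> a m) * (A $$ (j, b) * \<phi> b m)) * ?c"
        unfolding sum_distrib_right by (intro sum.cong refl) (simp add: mult_ac)
      also have "\<dots> = (\<Sum>a<k. A $$ (i, a) * \<phi> a m) * (\<Sum>b<k. A $$ (j, b) * \<phi> b m) * ?c"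
        by (simp add: sum_distrib_left)
      also have "\<dots> = lookup (gram k \<psi> p $$ (i, j)) m"
      proof (cases "m \<in> keys p")
        case True
        then show ?thesis using ij by (simp add: \<psi>)
      next
        case False
        then have "?c = 0" by (simp add: in_keys_iff)
        then show ?thesis using ij by simp
      qed
      finally show "lookup (\<Sum>b<k. (\<Sum>a<k. ?h (A $$ (i, a)) * ?G $$ (a, b)) * ?h (A $$ (j, b))) m =
          lookup (gram k \<psi> p $$ (i, j)) m" .
    qed
    finally show "gram k \<psi> p $$ (i, j) = (?A * ?G * transpose_mat ?A) $$ (i, j)" ..
  qed (use A in auto)
  then have "Determinant.det (gram k \<psi> p) = Determinant.det (?A * ?G) * Determinant.det (transpose_mat ?A)"
    using det_mult[of "?A * ?G" k "transpose_mat ?A"] A' T by simp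
  also have "Determinant.det (?A * ?G) = Determinant.det ?A * Determinant.det ?G"
    by (rule det_mult[OF A']) simp
  also have "Determinant.det (transpose_mat ?A) = Determinant.det ?A" by (rule det_transpose[OF A'])
  finally show ?thesis
    by (simp add: power2_eq_square const.hom_mult mult_ac)
qed

text \<open>
  Subtracting \<open>v\<close> matters when the support spans a proper affine subspace: it need not contain the
  origin, whereas \<open>representation\<close> is only meaningful on the span of the basis.
\<close>

definition affine_coord :: "'a::euclidean_space list \<Rightarrow> 'a \<Rightarrow> nat \<Rightarrow> 'a \<Rightarrow> complex" where
  "affine_coord bs v i m = (case i of 0 \<Rightarrow> 1
    | Suc i \<Rightarrow> complex_of_real (representation (set bs) (m - v) (bs ! i)))"

lemma affine_coord_simps [simp]:
  "affine_coord bs v 0 m = 1"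
  "affine_coord bs v (Suc i) m = complex_of_real (representation (set bs) (m - v) (bs ! i))"
  by (simp_all add: affine_coord_def)

section \<open>Schur complements\<close>

definition bordered :: "nat \<Rightarrow> 'b \<Rightarrow> (nat \<Rightarrow> 'b) \<Rightarrow> (nat \<Rightarrow> 'b) \<Rightarrow> (nat \<Rightarrow> nat \<Rightarrow> 'b) \<Rightarrow> 'b mat" where
  "bordered r f \<rho> \<gamma> H = Matrix.mat (Suc r) (Suc r) (\<lambda>(i, j). case i of
      0 \<Rightarrow> (case j of 0 \<Rightarrow> f | Suc j \<Rightarrow> \<rho> j)
    | Suc i \<Rightarrow> (case j of 0 \<Rightarrow> \<gamma> i | Suc j \<Rightarrow> H i j))"

lemma bordered_carrier [simp]: "bordered r f \<rho> \<gamma> H \<in> carrier_mat (Suc r) (Suc r)"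
  by (simp add: bordered_def)

lemma bordered_dim [simp]: "dim_row (bordered r f \<rho> \<gamma> H) = Suc r" "dim_col (bordered r f \<rho> \<gamma> H) = Suc r"
  by (simp_all add: bordered_def)

lemma det_bordered_lower:
  fixes f :: "'b::idom"
  shows "Determinant.det (bordered r f (\<lambda>_. 0) \<gamma> H) = f * Determinant.det (Matrix.mat r r (\<lambda>(i, j). H i j))"
proof -
  have "bordered r f (\<lambda>_. 0) \<gamma> H = four_block_mat (Matrix.mat 1 1 (\<lambda>_. f)) (0\<^sub>m 1 r)
      (Matrix.mat r 1 (\<lambda>(i, _). \<gamma> i)) (Matrix.mat r r (\<lambda>(i, j). H i j))"
    by (rule eq_matI) (auto simp: bordered_def split: nat.split)
  then show ?thesis
    by (simp add: det_four_block_mat_upper_right_zero[of _ 1 _ r] det_single)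
qed

lemma det_bordered_upper:
  fixes f :: "'b::idom"
  shows "Determinant.det (bordered r f \<rho> (\<lambda>_. 0) H) = f * Determinant.det (Matrix.mat r r (\<lambda>(i, j). H i j))"
proof -
  have "bordered r f \<rho> (\<lambda>_. 0) H = four_block_mat (Matrix.mat 1 1 (\<lambda>_. f)) 
      (Matrix.mat 1 r (\<lambda>(_, j). \<rho> j)) (0\<^sub>m r 1) (Matrix.mat r r (\<lambda>(i, j). H i j))"
    by (rule eq_matI) (auto simp: bordered_def split: nat.split)
  then show ?thesis
    by (simp add: det_four_block_mat_lower_left_zero[of _ 1 _ r] det_single)
qed

text \<open>
  Column operations clear the first row outside the corner.
\<close>

lemma det_bordered_schur:
  fixes f :: "'b::field"
  assumes f: "f \<noteq> 0"
  shows "Determinant.det (bordered r f \<rho> \<gamma> H) =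
    f * Determinant.det (Matrix.mat r r (\<lambda>(i, j). H i j - \<gamma> i * \<rho> j / f))"
proof -
  let ?N = "bordered r f \<rho> \<gamma> H"
  let ?P = "bordered r 1 (\<lambda>j. - \<rho> j / f) (\<lambda>_. 0) (\<lambda>i j. if i = j then 1 else 0)"
  let ?R = "bordered r f (\<lambda>_. 0) \<gamma> (\<lambda>i j. H i j - \<gamma> i * \<rho> j / f)"
  have "?N * ?P = ?R"
  proof (rule eq_matI)
    fix i j assume "i < dim_row ?R" "j < dim_col ?R"
    then have ij: "i < Suc r" "j < Suc r" by simp_all
    have "(?N * ?P) $$ (i, j) = (\<Sum>k<Suc r. ?N $$ (i, k) * ?P $$ (k, j))"
      using ij by (simp add: scalar_prod_def atLeast0LessThan)
    also have "\<dots> = ?R $$ (i, j)"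
      unfolding sum.lessThan_Suc_shift
      using ij f by (cases i; cases j) (simp_all add: bordered_def if_distrib cong: if_cong)
    finally show "(?N * ?P) $$ (i, j) = ?R $$ (i, j)" .
  qed simp_all
  moreover have "Determinant.det (?N * ?P) = Determinant.det ?N * Determinant.det ?P"
    by (rule det_mult[of _ "Suc r"]) simp_all
  moreover have "Matrix.mat r r (\<lambda>(i, j). if i = j then 1 else 0) = (1\<^sub>m r :: 'b mat)"
    by (rule eq_matI) auto
  ultimately show ?thesis by (simp add: det_bordered_upper det_bordered_lower)
qed

lemma comm_ring_hom_to_frac: "comm_ring_hom (to_frac :: ('a::euclidean_space \<Rightarrow>\<^sub>0 complex) \<Rightarrow> _)"
proof
  fix x y :: "'a \<Rightarrow>\<^sub>0 complex"
  show "to_frac (x + y) = to_frac x + to_frac y"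
    by (simp add: to_frac_def plus_group_algebra.abs_eq flip: to_fract_add)
  show "to_frac (x * y) = to_frac x * to_frac y"
    by (simp add: to_frac_def times_group_algebra.abs_eq flip: to_fract_mult)
qed (simp_all add: to_frac_def flip: zero_group_algebra.abs_eq one_group_algebra.abs_eq)

lemma to_frac_inject: "to_frac p = to_frac q \<longleftrightarrow> p = q"
  by (simp add: to_frac_def Abs_group_algebra_inject)

text \<open>
  The Hessian of \<open>log q\<close> is, up to the factor \<open>1/q\<close>, the Schur complement of the corner entry \<open>q\<close>
  in the Gram matrix.
\<close>

lemma det_log_deriv2:
  fixes q :: "'a::euclidean_space \<Rightarrow>\<^sub>0 complex" and bs :: "'a list"
  defines "r \<equiv> length bs"
  assumes q: "q \<noteq> 0"
  shows "to_frac q ^ (r + 1) *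
      Determinant.det (Matrix.mat r r (\<lambda>(i, j). log_deriv2 (set bs) (bs ! i) (bs ! j) q)) =
    to_frac (Determinant.det (gram (Suc r) (affine_coord bs 0) q))"
proof -
  interpret frac: comm_ring_hom "to_frac :: ('a \<Rightarrow>\<^sub>0 complex) \<Rightarrow> _" by (rule comm_ring_hom_to_frac)
  define f where "f = to_frac q"
  define d where "d i = to_frac (euler_deriv (set bs) (bs ! i) q)" for i
  define H where "H i j = to_frac (euler_deriv (set bs) (bs ! i) (euler_deriv (set bs) (bs ! j) q))" for i j
  have f: "f \<noteq> 0" using q to_frac_inject[of q 0] by (simp add: f_def)
  have "map_mat to_frac (gram (Suc r) (affine_coord bs 0) q) = bordered r f d d H"
    by (rule eq_matI)
      (auto simp: bordered_def gram_def f_def d_def H_def euler_deriv_eq_weight weight_weight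
        split: nat.split)
  then have "to_frac (Determinant.det (gram (Suc r) (affine_coord bs 0) q)) =
      Determinant.det (bordered r f d d H)"
    by (metis frac.hom_det)
  also have "\<dots> = f * Determinant.det (Matrix.mat r r (\<lambda>(i, j). H i j - d i * d j / f))"
    by (rule det_bordered_schur[OF f])
  also have "Matrix.mat r r (\<lambda>(i, j). H i j - d i * d j / f) =
      f \<cdot>\<^sub>m Matrix.mat r r (\<lambda>(i, j). log_deriv2 (set bs) (bs ! i) (bs ! j) q)"
    using f by (intro eq_matI) (auto simp: log_deriv2_def f_def[symmetric] d_def[symmetric] H_def[symmetric]
        field_simps power2_eq_square)
  finally show ?thesis by (simp add: f_def)
qed

section \<open>The operator \<open>\<mu>\<close> as a Gram determinant\<close>

text \<open>
  Passing from \<open>(cs, w)\<close> to \<open>(bs, v)\<close> is an affine map, that is, a linear map on coordinates with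
  a constant \<open>1\<close> in front. Its matrix has the linear part as a block, so its determinant is \<open>\<plusminus>1\<close>.
\<close>

lemma det_gram_affine_coord_change:
  fixes p :: "'a::euclidean_space \<Rightarrow>\<^sub>0 complex"
  assumes bs: "distinct bs" "lattice_basis (set bs) L"
    and cs: "distinct cs" "lattice_basis (set cs) L"
    and w: "w - v \<in> span L" and keys: "\<And>m. m \<in> keys p \<Longrightarrow> m - w \<in> span L"
  shows "Determinant.det (gram (Suc (length bs)) (affine_coord bs v) p) =
    Determinant.det (gram (Suc (length cs)) (affine_coord cs w) p)"
proof -
  let ?n = "length cs"
  have len: "length bs = ?n" using det_lattice_basis_change(1)[OF bs cs] .
  have ind: "independent (set bs)" "independent (set cs)"
    and L: "L = int_span (set bs)" "L = int_span (set cs)"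
    using assms by (auto simp: lattice_basis_def)
  have sp: "span (set bs) = span L" "span (set cs) = span L"
    using lattice_basis_span[OF bs(2)] lattice_basis_span[OF cs(2)] by simp_all
  let ?A = "bordered ?n 1 (\<lambda>_. 0)
    (\<lambda>i. complex_of_real (representation (set bs) (w - v) (bs ! i)))
    (\<lambda>i j. complex_of_real (representation (set bs) (cs ! j) (bs ! i)))"
  have "Determinant.det (gram (Suc ?n) (affine_coord bs v) p) =
      Poly_Mapping.single 0 (Determinant.det ?A ^ 2) * Determinant.det (gram (Suc ?n) (affine_coord cs w) p)"
  proof (rule det_gram_linear_change)
    fix i m assume i: "i < Suc ?n" and m: "m \<in> keys p"
    show "affine_coord bs v i m = (\<Sum>j<Suc ?n. ?A $$ (i, j) * affine_coord cs w j m)"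
    proof (cases i)
      case 0
      then show ?thesis unfolding sum.lessThan_Suc_shift by (simp add: bordered_def)
    next
      case (Suc k)
      have "representation (set bs) (m - v) (bs ! k) =
          representation (set bs) (w - v) (bs ! k) + representation (set bs) (m - w) (bs ! k)"
        using representation_add[OF ind(1), of "w - v" "m - w"] w keys[OF m] sp by simp
      also have "representation (set bs) (m - w) (bs ! k) =
          (\<Sum>j<?n. representation (set cs) (m - w) (cs ! j) * representation (set bs) (cs ! j) (bs ! k))"
        using representation_change[OF ind, of "m - w" "bs ! k"] keys[OF m] sp
        by (simp add: sum_set_nth[OF cs(1)])
      finally show ?thesis unfolding sum.lessThan_Suc_shift using Suc i
        by (simp add: bordered_def mult.commute)
    qed
  qed simp
  then show ?thesis
    by (simp add: det_bordered_lower det_lattice_basis_change(2)[OF bs cs] len)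
qed

lemma lookup_signof_mult:
  "lookup (signof \<pi> * f) m = signof \<pi> * lookup (f :: 'a::euclidean_space \<Rightarrow>\<^sub>0 complex) m"
  by (cases \<pi> rule: sign_cases) simp_all

lemma keys_det_subset:
  fixes A :: "('a::euclidean_space \<Rightarrow>\<^sub>0 complex) mat"
  assumes A: "A \<in> carrier_mat k k" "\<And>i j. i < k \<Longrightarrow> j < k \<Longrightarrow> keys (A $$ (i, j)) \<subseteq> M"
    and M: "0 \<in> M" "\<And>x y. x \<in> M \<Longrightarrow> y \<in> M \<Longrightarrow> x + y \<in> M"
  shows "keys (Determinant.det A) \<subseteq> M"
proof -
  have prod: "keys (\<Prod>i\<in>I. f i) \<subseteq> M" if "finite I" "\<And>i. i \<in> I \<Longrightarrow> keys (f i) \<subseteq> M"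
    for I :: "nat set" and f :: "nat \<Rightarrow> 'a \<Rightarrow>\<^sub>0 complex"
    using that
  proof (induction I rule: finite_induct)
    case (insert i I)
    show ?case
    proof
      fix m assume "m \<in> keys (\<Prod>i\<in>insert i I. f i)"
      then have "m \<in> keys (f i * (\<Prod>i\<in>I. f i))" using insert.hyps by simp
      then obtain a b where ab: "a \<in> keys (f i)" "b \<in> keys (\<Prod>i\<in>I. f i)" "m = a + b"
        using subsetD[OF keys_mult] by blast
      moreover have "keys (f i) \<subseteq> M" by (rule insert.prems) simp
      moreover have "keys (\<Prod>i\<in>I. f i) \<subseteq> M" by (rule insert.IH) (rule insert.prems, simp)
      ultimately show "m \<in> M" using M(2) by blast
    qed
  qed (auto simp: in_keys_iff lookup_one when_def M(1) split: if_splits)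
  show ?thesis
  proof
    fix m assume m: "m \<in> keys (Determinant.det A)"
    show "m \<in> M"
    proof (rule ccontr)
      assume "m \<notin> M"
      have "lookup (\<Prod>i = 0..<k. A $$ (i, \<pi> i)) m = 0" if "\<pi> permutes {0..<k}" for \<pi>
      proof -
        have "keys (\<Prod>i = 0..<k. A $$ (i, \<pi> i)) \<subseteq> M"
          using permutes_in_image[OF that] by (intro prod A(2)) auto
        then show ?thesis using \<open>m \<notin> M\<close> by (auto simp: in_keys_iff)
      qed
      then have "lookup (Determinant.det A) m = 0"
        by (simp add: det_def'[OF A(1)] lookup_sum lookup_signof_mult)
      then show False using m by (simp add: in_keys_iff)
    qed
  qed
qed

text \<open>
  The defining equation of \<open>\<mu>\<close> translates the support to a point \<open>m\<^sub>0\<close> and uses an unspecified basis;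
  both choices drop out here. Translating the support multiplies each of the \<open>r + 1\<close> rows of the Gram
  matrix by one monomial, and the factor \<open>p\<^bsup>r+1\<^esup>\<close> compensates for this.
\<close>

lemma mu_eq_det_gram:
  fixes p :: "'a::euclidean_space \<Rightarrow>\<^sub>0 complex"
  assumes M: "full_lattice M" and p: "p \<in> laurent_polys M" and v: "v \<in> keys p"
    and bs: "distinct bs" "lattice_basis (set bs) (difference_lattice M p)"
  shows "mu M p = Determinant.det (gram (Suc (length bs)) (affine_coord bs v) p)"
proof -
  interpret frac: comm_ring_hom "to_frac :: ('a \<Rightarrow>\<^sub>0 complex) \<Rightarrow> _" by (rule comm_ring_hom_to_frac)
  obtain B0 where B0: "M = int_span B0" using M by (auto simp: full_lattice_def lattice_basis_def)
  define L where "L = difference_lattice M p"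
  define cs where "cs = chosen_basis L"
  define r where "r = lattice_rank L"
  define m0 where "m0 = (SOME m. m \<in> keys p)"
  define q where "q = Poly_Mapping.single (- m0) 1 * p"
  have r: "r = length cs" by (simp add: r_def lattice_rank_def cs_def)
  have m0: "m0 \<in> keys p" unfolding m0_def using v by (rule someI)
  have cs: "distinct cs" "lattice_basis (set cs) L"
    using someI[of "\<lambda>bs. distinct bs \<and> lattice_basis (set bs) L" bs] bs
    by (auto simp: cs_def chosen_basis_def L_def)
  have pq: "p = Poly_Mapping.single m0 1 * q"
    by (rule poly_mapping_eqI) (simp add: q_def lookup_monom_mult)
  have q0: "q \<noteq> 0" using v pq by auto
  have diff: "x - y \<in> L" if "x \<in> keys p" "y \<in> keys p" for x y
    using that p unfolding L_def difference_lattice_def laurent_polys_def B0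
    by (auto intro!: int_span_diff span_base)
  let ?g = "Determinant.det (gram (Suc (length bs)) (affine_coord bs v) p)"
  have "?g = Determinant.det (gram (Suc r) (affine_coord cs m0) p)"
    unfolding r using bs cs diff m0 v
    by (intro det_gram_affine_coord_change[of _ L]) (auto simp: L_def intro: span_base)
  also have "gram (Suc r) (affine_coord cs m0) p =
      Poly_Mapping.single m0 1 \<cdot>\<^sub>m gram (Suc r) (affine_coord cs 0) q"
  proof (rule eq_matI)
    fix i j assume "i < dim_row (Poly_Mapping.single m0 1 \<cdot>\<^sub>m gram (Suc r) (affine_coord cs 0) q)"
      "j < dim_col (Poly_Mapping.single m0 1 \<cdot>\<^sub>m gram (Suc r) (affine_coord cs 0) q)"
    then have ij: "i < Suc r" "j < Suc r" by simp_all
    have "affine_coord cs m0 i (m0 + m) = affine_coord cs 0 i m" for i m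
      by (cases i) simp_all
    then show "gram (Suc r) (affine_coord cs m0) p $$ (i, j) =
      (Poly_Mapping.single m0 1 \<cdot>\<^sub>m gram (Suc r) (affine_coord cs 0) q) $$ (i, j)"
      using ij by (simp add: pq weight_monom_mult)
  qed simp_all
  finally have "?g = Poly_Mapping.single m0 1 ^ (r + 1) * Determinant.det (gram (Suc r) (affine_coord cs 0) q)"
    by simp
  then have "to_frac ?g = to_frac (Poly_Mapping.single m0 1) ^ (r + 1) *
      to_frac (Determinant.det (gram (Suc r) (affine_coord cs 0) q))"
    by (simp only: frac.hom_mult frac.hom_power)
  also have "to_frac (Determinant.det (gram (Suc r) (affine_coord cs 0) q)) = to_frac q ^ (r + 1) * delta L q"
    using det_log_deriv2[OF q0, of cs] by (simp add: delta_def r_def[symmetric] cs_def[symmetric] r Let_def)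
  finally have g: "to_frac ?g = to_frac p ^ (r + 1) * delta L q"
    by (simp add: pq frac.hom_mult power_mult_distrib mult_ac)
  have gM: "?g \<in> laurent_polys M"
  proof -
    have "keys ?g \<subseteq> M"
    proof (rule keys_det_subset[OF gram_carrier])
      show "keys (gram (Suc (length bs)) (affine_coord bs v) p $$ (i, j)) \<subseteq> M"
        if "i < Suc (length bs)" "j < Suc (length bs)" for i j
        using keys_weight[of _ p] p that by (auto simp: laurent_polys_def)
    qed (simp_all add: B0 int_span_0 int_span_add)
    then show ?thesis by (simp add: laurent_polys_def)
  qed
  have "mu M p = (THE g. g \<in> laurent_polys M \<and> to_frac g = to_frac p ^ (r + 1) * delta L q)"
    by (simp add: mu_def Let_def L_def r_def m0_def q_def)
  also have "\<dots> = ?g"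
    by (rule the_equality) (use g gM to_frac_inject in metis)+
  finally show ?thesis .
qed

section \<open>The part of lowest level\<close>

lemma lookup_restrict_supp [simp]:
  "lookup (restrict_supp p S) m = (if m \<in> S then lookup p m else 0)"
  by (auto simp: restrict_supp_def lookup_sum_single in_keys_iff)

lemma keys_restrict_supp [simp]: "keys (restrict_supp p S) = keys p \<inter> S"
  by (auto simp: in_keys_iff split: if_splits)

lemma restrict_supp_cong: "keys p \<inter> S = keys p \<inter> T \<Longrightarrow> restrict_supp p S = restrict_supp p T"
  by (simp add: restrict_supp_def)

lemma restrict_supp_add: "restrict_supp (f + g) S = restrict_supp f S + restrict_supp g S"
  by (rule poly_mapping_eqI) (simp add: lookup_add)

lemma restrict_supp_sum: "restrict_supp (\<Sum>x\<in>X. f x) S = (\<Sum>x\<in>X. restrict_supp (f x) S)"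
  by (rule poly_mapping_eqI) (simp add: lookup_sum)

lemma restrict_supp_id: "keys f \<subseteq> S \<Longrightarrow> restrict_supp f S = f"
  by (rule poly_mapping_eqI) (auto simp: in_keys_iff)

lemma restrict_supp_disjoint: "keys f \<inter> S = {} \<Longrightarrow> restrict_supp f S = 0"
  by (rule poly_mapping_eqI) (auto simp: in_keys_iff)

abbreviation level :: "'a::euclidean_space \<Rightarrow> real \<Rightarrow> 'a set" where
  "level u a \<equiv> {m. inner u m = a}"

text \<open>
  Lowest parts multiply: a product of monomials of levels at least \<open>a\<close> and \<open>b\<close> has level \<open>a + b\<close>
  only if both bounds are attained.
\<close>

lemma restrict_supp_level_mult:
  fixes f g :: "'a::euclidean_space \<Rightarrow>\<^sub>0 complex"
  assumes f: "\<And>m. m \<in> keys f \<Longrightarrow> a \<le> inner u m"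
    and g: "\<And>m. m \<in> keys g \<Longrightarrow> b \<le> inner u m"
  shows "restrict_supp (f * g) (level u (a + b)) =
    restrict_supp f (level u a) * restrict_supp g (level u b)"
proof -
  define f0 where "f0 = restrict_supp f (level u a)"
  define f1 where "f1 = restrict_supp f (- level u a)"
  define g0 where "g0 = restrict_supp g (level u b)"
  define g1 where "g1 = restrict_supp g (- level u b)"
  have fs: "f = f0 + f1" and gs: "g = g0 + g1"
    by (rule poly_mapping_eqI; simp add: f0_def f1_def g0_def g1_def lookup_add)+
  have f1: "a < inner u m" if "m \<in> keys f1" for m
    using f[of m] that by (auto simp: f1_def)
  have g1: "b < inner u m" if "m \<in> keys g1" for m
    using g[of m] that by (auto simp: g1_def)
  have f0: "a = inner u m" if "m \<in> keys f0" for m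
    using that by (auto simp: f0_def)
  have g0: "b = inner u m" if "m \<in> keys g0" for m
    using that by (auto simp: g0_def)
  let ?L = "level u (a + b)"
  have "restrict_supp (f0 * g0) ?L = f0 * g0"
    by (rule restrict_supp_id) (use keys_mult[of f0 g0] f0 g0 in \<open>force simp: inner_add_right\<close>)
  moreover have "restrict_supp (f0 * g1) ?L = 0"
    by (rule restrict_supp_disjoint) (use keys_mult[of f0 g1] f0 g1 in \<open>force simp: inner_add_right\<close>)
  moreover have "restrict_supp (f1 * g) ?L = 0"
    by (rule restrict_supp_disjoint) (use keys_mult[of f1 g] f1 g in \<open>force simp: inner_add_right\<close>)
  moreover have "f * g = f0 * g0 + f0 * g1 + f1 * g"
    by (subst fs, subst (2) gs) (simp add: algebra_simps gs)
  ultimately show ?thesis by (simp add: restrict_supp_add f0_def g0_def)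
qed

lemma level_mult_ge:
  fixes f g :: "'a::euclidean_space \<Rightarrow>\<^sub>0 complex"
  assumes f: "\<And>m. m \<in> keys f \<Longrightarrow> a \<le> inner u m"
    and g: "\<And>m. m \<in> keys g \<Longrightarrow> b \<le> inner u m"
    and m: "m \<in> keys (f * g)"
  shows "a + b \<le> inner u m"
  using keys_mult[of f g] f g m by (fastforce simp: inner_add_right add_mono)

lemma restrict_supp_level_prod:
  fixes f :: "'i \<Rightarrow> 'a::euclidean_space \<Rightarrow>\<^sub>0 complex"
  assumes "finite I" and "\<And>i m. i \<in> I \<Longrightarrow> m \<in> keys (f i) \<Longrightarrow> w i \<le> inner u m"
  shows "restrict_supp (\<Prod>i\<in>I. f i) (level u (\<Sum>i\<in>I. w i)) =
      (\<Prod>i\<in>I. restrict_supp (f i) (level u (w i)))"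
    and "m \<in> keys (\<Prod>i\<in>I. f i) \<Longrightarrow> (\<Sum>i\<in>I. w i) \<le> inner u m"
proof -
  have "restrict_supp (\<Prod>i\<in>I. f i) (level u (\<Sum>i\<in>I. w i)) =
      (\<Prod>i\<in>I. restrict_supp (f i) (level u (w i))) \<and>
      (\<forall>m. m \<in> keys (\<Prod>i\<in>I. f i) \<longrightarrow> (\<Sum>i\<in>I. w i) \<le> inner u m)"
    using assms
  proof (induction I rule: finite_induct)
    case empty
    then show ?case
      by (auto intro!: restrict_supp_id simp: in_keys_iff lookup_one when_def split: if_splits)
  next
    case (insert i I)
    have 1: "w i \<le> inner u m" if "m \<in> keys (f i)" for m using insert.prems that by blast
    have c: "restrict_supp (\<Prod>i\<in>I. f i) (level u (\<Sum>i\<in>I. w i)) =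
      (\<Prod>i\<in>I. restrict_supp (f i) (level u (w i))) \<and>
      (\<forall>m. m \<in> keys (\<Prod>i\<in>I. f i) \<longrightarrow> (\<Sum>i\<in>I. w i) \<le> inner u m)"
      by (rule insert.IH) (rule insert.prems, simp_all)
    have IH: "restrict_supp (\<Prod>i\<in>I. f i) (level u (\<Sum>i\<in>I. w i)) =
      (\<Prod>i\<in>I. restrict_supp (f i) (level u (w i)))"
      using c by blast
    have 2: "(\<Sum>i\<in>I. w i) \<le> inner u m" if "m \<in> keys (\<Prod>i\<in>I. f i)" for m
      using c that by blast
    show ?case
      using restrict_supp_level_mult[OF 1 2] level_mult_ge[OF 1 2] insert.hyps IH
      by simp
  qed
  then show "restrict_supp (\<Prod>i\<in>I. f i) (level u (\<Sum>i\<in>I. w i)) =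
      (\<Prod>i\<in>I. restrict_supp (f i) (level u (w i)))"
    and "m \<in> keys (\<Prod>i\<in>I. f i) \<Longrightarrow> (\<Sum>i\<in>I. w i) \<le> inner u m" by simp_all
qed

lemma keys_det_ge:
  fixes A :: "('a::euclidean_space \<Rightarrow>\<^sub>0 complex) mat"
  assumes A: "A \<in> carrier_mat k k"
    and w: "\<And>i j m. i < k \<Longrightarrow> j < k \<Longrightarrow> m \<in> keys (A $$ (i, j)) \<Longrightarrow> w i \<le> inner u m"
    and m: "m \<in> keys (Determinant.det A)"
  shows "(\<Sum>i<k. w i) \<le> inner u m"
proof -
  have "\<exists>\<pi>. \<pi> permutes {0..<k} \<and> m \<in> keys (\<Prod>i = 0..<k. A $$ (i, \<pi> i))"
  proof (rule ccontr)
    assume "\<not> ?thesis"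
    then have "lookup (\<Prod>i = 0..<k. A $$ (i, \<pi> i)) m = 0" if "\<pi> permutes {0..<k}" for \<pi>
      using that by (auto simp: in_keys_iff)
    then have "lookup (Determinant.det A) m = 0"
      by (simp add: det_def'[OF A] lookup_sum lookup_signof_mult)
    then show False using m by (simp add: in_keys_iff)
  qed
  then obtain \<pi> where \<pi>: "\<pi> permutes {0..<k}" "m \<in> keys (\<Prod>i = 0..<k. A $$ (i, \<pi> i))" by blast
  have "\<pi> i < k" if "i < k" for i using permutes_in_image[OF \<pi>(1), of i] that by simp
  then have "(\<Sum>i = 0..<k. w i) \<le> inner u m"
    by (intro restrict_supp_level_prod(2)[OF _ _ \<pi>(2)]) (use w in auto)
  then show ?thesis by (simp add: atLeast0LessThan)
qed

text \<open>
  Every term of the Leibniz expansion takes one entry from each row, so lower bounds \<open>w i\<close> that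
  depend on the row alone give the same bound for all terms.
\<close>

lemma restrict_supp_level_det:
  fixes A :: "('a::euclidean_space \<Rightarrow>\<^sub>0 complex) mat"
  assumes A: "A \<in> carrier_mat k k"
    and w: "\<And>i j m. i < k \<Longrightarrow> j < k \<Longrightarrow> m \<in> keys (A $$ (i, j)) \<Longrightarrow> w i \<le> inner u m"
  shows "restrict_supp (Determinant.det A) (level u (\<Sum>i<k. w i)) =
    Determinant.det (Matrix.mat k k (\<lambda>(i, j). restrict_supp (A $$ (i, j)) (level u (w i))))"
proof -
  have sgn: "restrict_supp (signof \<pi> * f) S = signof \<pi> * restrict_supp f S"
    for \<pi> and f :: "'a \<Rightarrow>\<^sub>0 complex" and S
    by (rule poly_mapping_eqI) (simp add: lookup_signof_mult)
  have "restrict_supp (\<Prod>i = 0..<k. A $$ (i, \<pi> i)) (level u (\<Sum>i<k. w i)) =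
      (\<Prod>i = 0..<k. restrict_supp (A $$ (i, \<pi> i)) (level u (w i)))"
    if "\<pi> permutes {0..<k}" for \<pi>
  proof -
    have "\<pi> i < k" if "i < k" for i using permutes_in_image[OF \<open>\<pi> permutes _\<close>, of i] that by simp
    then show ?thesis
      unfolding atLeast0LessThan by (intro restrict_supp_level_prod(1)) (use w in auto)
  qed
  moreover have "(\<Prod>i = 0..<k. Matrix.mat k k (\<lambda>(i, j). restrict_supp (A $$ (i, j)) (level u (w i))) $$ (i, \<pi> i))
      = (\<Prod>i = 0..<k. restrict_supp (A $$ (i, \<pi> i)) (level u (w i)))"
    if "\<pi> permutes {0..<k}" for \<pi>
    using permutes_in_image[OF that] by (intro prod.cong) auto
  ultimately show ?thesis
    by (simp add: det_def'[OF A] det_def'[of _ k] restrict_supp_sum sgn)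
qed

text \<open>
  The weight \<open>\<phi> k\<close> vanishes on level \<open>h\<close> and equals \<open>1\<close> on level \<open>h + 1\<close>. Hence the lowest part of
  the Gram matrix, with level \<open>h\<close> in the first \<open>k\<close> rows and level \<open>h + 1\<close> in the last one, has a
  last column that is zero up to its last entry, and that entry is the level \<open>h + 1\<close> part of \<open>p\<close>.
\<close>

lemma gram_level:
  fixes p :: "'a::euclidean_space \<Rightarrow>\<^sub>0 complex"
  assumes lev: "\<And>m. m \<in> keys p \<Longrightarrow> inner u m = h \<or> h + 1 \<le> inner u m"
    and \<phi>: "\<And>m. m \<in> keys p \<Longrightarrow> \<phi> k m = complex_of_real (inner u m - h)"
  shows "restrict_supp (Determinant.det (gram (Suc k) \<phi> p)) (level u (real (Suc k) * h + 1)) =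
      Determinant.det (gram k \<phi> (restrict_supp p (level u h))) * restrict_supp p (level u (h + 1))"
      (is "?lhs = ?rhs")
    and "m \<in> keys (Determinant.det (gram (Suc k) \<phi> p)) \<Longrightarrow> real (Suc k) * h + 1 \<le> inner u m"
proof -
  define w where "w i = (if i = k then h + 1 else h)" for i
  have sw: "(\<Sum>i<Suc k. w i) = real (Suc k) * h + 1"
    by (simp add: w_def algebra_simps)
  have ge: "w i \<le> inner u m"
    if "i < Suc k" "j < Suc k" "m \<in> keys (gram (Suc k) \<phi> p $$ (i, j))" for i j m
  proof -
    have "m \<in> keys p" "\<phi> i m \<noteq> 0" using that by (auto simp: in_keys_iff)
    then show ?thesis using lev[of m] \<phi>[of m] by (auto simp: w_def)
  qed
  show "real (Suc k) * h + 1 \<le> inner u m" if "m \<in> keys (Determinant.det (gram (Suc k) \<phi> p))"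
    unfolding sw[symmetric] by (rule keys_det_ge[OF gram_carrier ge that])
  let ?p0 = "restrict_supp p (level u h)" and ?p1 = "restrict_supp p (level u (h + 1))"
  let ?N = "Matrix.mat (Suc k) (Suc k)
    (\<lambda>(i, j). restrict_supp (gram (Suc k) \<phi> p $$ (i, j)) (level u (w i)))"
  let ?C = "Matrix.mat 1 k (\<lambda>(i, j). restrict_supp (gram (Suc k) \<phi> p $$ (k, j)) (level u (h + 1)))"
  have "?lhs = Determinant.det ?N"
    unfolding sw[symmetric] by (rule restrict_supp_level_det[OF gram_carrier ge])
  also have "?N = four_block_mat (gram k \<phi> ?p0) (0\<^sub>m k 1) ?C (Matrix.mat 1 1 (\<lambda>_. ?p1))"
  proof (rule eq_matI)
    fix i j assume "i < dim_row (four_block_mat (gram k \<phi> ?p0) (0\<^sub>m k 1) ?C (Matrix.mat 1 1 (\<lambda>_. ?p1)))"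
      "j < dim_col (four_block_mat (gram k \<phi> ?p0) (0\<^sub>m k 1) ?C (Matrix.mat 1 1 (\<lambda>_. ?p1)))"
    then have ij: "i < Suc k" "j < Suc k" by simp_all
    consider "i < k" "j < k" | "i < k" "j = k" | "i = k" "j < k" | "i = k" "j = k"
      using ij by linarith
    then show "?N $$ (i, j) =
      four_block_mat (gram k \<phi> ?p0) (0\<^sub>m k 1) ?C (Matrix.mat 1 1 (\<lambda>_. ?p1)) $$ (i, j)"
    proof cases
      case 1
      then show ?thesis by (simp add: w_def) (rule poly_mapping_eqI, simp)
    next
      case 2
      have "\<phi> k m * lookup p m = 0" if "inner u m = h" for m
        using \<phi>[of m] that by (cases "m \<in> keys p") (auto simp: in_keys_iff)
      then show ?thesis using 2 by (simp add: w_def) (rule poly_mapping_eqI, simp add: mult.assoc)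
    next
      case 3
      then show ?thesis by (simp add: w_def)
    next
      case 4
      have "\<phi> k m * \<phi> k m * lookup p m = lookup p m" if "inner u m = h + 1" for m
        using \<phi>[of m] that by (cases "m \<in> keys p") (auto simp: in_keys_iff)
      then show ?thesis using 4 by (simp add: w_def) (rule poly_mapping_eqI, simp)
    qed
  qed simp_all
  also have "Determinant.det \<dots> = Determinant.det (gram k \<phi> ?p0) * Determinant.det (Matrix.mat 1 1 (\<lambda>_. ?p1))"
    by (rule det_four_block_mat_upper_right_zero_col) auto
  also have "Determinant.det (Matrix.mat 1 1 (\<lambda>_. ?p1)) = ?p1"
    by (simp add: det_single)
  finally show "?lhs = ?rhs" .
qed

text \<open>
  By induction on the number of coordinates: the lowest part in the last coordinate is, by
  \<open>gram_level\<close>, a product of the determinant for the support at \<open>u\<^sub>k = u\<^sub>k(v)\<close> and a factor that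
  contains the monomial of \<open>v + b\<^sub>k\<close>. When no coordinates remain, only the monomial of \<open>v\<close> is left.
\<close>

lemma det_gram_nonzero:
  fixes p :: "'a::euclidean_space \<Rightarrow>\<^sub>0 complex"
  assumes \<phi>0: "\<And>m. m \<in> keys p \<Longrightarrow> \<phi> 0 m = 1"
    and \<phi>: "\<And>i m. i < k \<Longrightarrow> m \<in> keys p \<Longrightarrow> \<phi> (Suc i) m = complex_of_real (inner (u i) (m - v))"
    and nat: "\<And>i m. i < k \<Longrightarrow> m \<in> keys p \<Longrightarrow> inner (u i) (m - v) \<in> \<nat>"
    and v: "v \<in> keys p" and b: "\<And>i. i < k \<Longrightarrow> v + b i \<in> keys p"
    and dual: "\<And>i j. i < k \<Longrightarrow> j < k \<Longrightarrow> inner (u i) (b j) = (if i = j then 1 else 0)"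
    and uniq: "\<And>m. m \<in> keys p \<Longrightarrow> (\<And>i. i < k \<Longrightarrow> inner (u i) (m - v) = 0) \<Longrightarrow> m = v"
  shows "Determinant.det (gram (Suc k) \<phi> p) \<noteq> 0"
  using assms
proof (induction k arbitrary: p)
  case 0
  have "gram (Suc 0) \<phi> p = Matrix.mat 1 1 (\<lambda>_. weight (\<lambda>m. \<phi> 0 m * \<phi> 0 m) p)"
    by (rule eq_matI) auto
  also have "weight (\<lambda>m. \<phi> 0 m * \<phi> 0 m) p = weight (\<lambda>_. 1) p"
    by (rule weight_cong) (simp add: 0)
  finally have "Determinant.det (gram (Suc 0) \<phi> p) = p" by (simp add: det_single)
  then show ?case using 0 by auto
next
  case (Suc k)
  define h where "h = inner (u k) v"
  let ?p0 = "restrict_supp p (level (u k) h)" and ?p1 = "restrict_supp p (level (u k) (h + 1))"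
  have lev: "inner (u k) m = h \<or> h + 1 \<le> inner (u k) m" if m: "m \<in> keys p" for m
  proof -
    obtain n :: nat where "inner (u k) (m - v) = real n" using Suc.prems(3)[OF _ m, of k] by (auto elim: Nats_cases)
    then show ?thesis by (cases n) (auto simp: h_def inner_diff_right)
  qed
  have "Determinant.det (gram (Suc k) \<phi> ?p0) \<noteq> 0"
  proof (rule Suc.IH)
    show "m = v" if "m \<in> keys ?p0" "\<And>i. i < k \<Longrightarrow> inner (u i) (m - v) = 0" for m
    proof (rule Suc.prems(7))
      show "m \<in> keys p" using that by simp
      show "inner (u i) (m - v) = 0" if "i < Suc k" for i
        using that \<open>m \<in> keys ?p0\<close> \<open>\<And>i. i < k \<Longrightarrow> inner (u i) (m - v) = 0\<close>
        by (cases "i = k") (auto simp: h_def inner_diff_right)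
    qed
    show "v + b i \<in> keys ?p0" if "i < k" for i
      using that Suc.prems(5,6) by (simp add: inner_add_right h_def)
  qed (use Suc.prems in \<open>auto simp: h_def\<close>)
  moreover have "v + b k \<in> keys ?p1"
    using Suc.prems(5,6) by (simp add: inner_add_right h_def)
  then have "?p1 \<noteq> 0" by (metis empty_iff keys_zero)
  ultimately have "Determinant.det (gram (Suc k) \<phi> ?p0) * ?p1 \<noteq> 0"
    by (rule group_algebra_no_zero_divisors)
  moreover have "\<phi> (Suc k) m = complex_of_real (inner (u k) m - h)" if "m \<in> keys p" for m
    using Suc.prems(2)[of k m] that by (simp add: h_def inner_diff_right)
  ultimately have "restrict_supp (Determinant.det (gram (Suc (Suc k)) \<phi> p))
      (level (u k) (real (Suc (Suc k)) * h + 1)) \<noteq> 0"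
    using gram_level(1)[of p "u k" h \<phi> "Suc k"] lev by simp
  then show ?case by (auto simp: restrict_supp_def)
qed

text \<open>
  A half-line generated by \<open>u\<close> cuts out the face on which \<open>u\<close> is minimal. To find that minimum on
  the Newton polytope it is enough to have a lower bound that is attained at some exponent.
\<close>

lemma init_part_ray:
  assumes \<tau>: "\<tau> = {c *\<^sub>R u | c. 0 \<le> c}"
    and ge: "\<And>m. m \<in> keys g \<Longrightarrow> K \<le> inner u m"
    and ne: "restrict_supp g (level u K) \<noteq> 0"
  shows "init_part \<tau> g = restrict_supp g (level u K)"
proof -
  obtain m1 where m1: "m1 \<in> keys g" "inner u m1 = K"
  proof -
    have "keys (restrict_supp g (level u K)) \<noteq> {}" using ne by (simp only: keys_eq_empty) simp
    then show ?thesis using that by auto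
  qed
  let ?P = "convex hull (keys g)"
  have geP: "K \<le> inner u x" if "x \<in> ?P" for x
  proof -
    have "?P \<subseteq> {x. inner u x \<ge> K}"
      by (rule hull_minimal) (use ge convex_halfspace_ge in auto)
    then show ?thesis using that by blast
  qed
  have "keys g \<inter> cone_face ?P \<tau> = keys g \<inter> level u K"
  proof (rule Set.set_eqI, rule iffI)
    fix y assume y: "y \<in> keys g \<inter> cone_face ?P \<tau>"
    have "u \<in> \<tau>" using \<tau> by (auto intro!: exI[of _ 1])
    moreover have "m1 \<in> ?P" using m1(1) by (rule hull_inc)
    ultimately have "0 \<le> inner u (m1 - y)" using y by (auto simp: cone_face_def)
    then show "y \<in> keys g \<inter> level u K" using y ge[of y] m1(2) by (auto simp: inner_diff_right)
  next
    fix y assume y: "y \<in> keys g \<inter> level u K"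
    have "0 \<le> inner z (x - y)" if z: "z \<in> \<tau>" and x: "x \<in> ?P" for z x
    proof -
      obtain c where "z = c *\<^sub>R u" "0 \<le> c" using z \<tau> by blast
      then show ?thesis using geP[OF x] y by (simp add: inner_diff_right mult_left_mono)
    qed
    moreover have "y \<in> ?P" using y by (intro hull_inc) simp
    ultimately show "y \<in> keys g \<inter> cone_face ?P \<tau>" using y by (simp add: cone_face_def)
  qed
  then show ?thesis
    unfolding init_part_def newton_polytope_def by (rule restrict_supp_cong)
qed

section \<open>Rays of the normal fan of a unimodular set\<close>

text \<open>
  The edges at \<open>v\<close> point along the basis vectors provided by unimodularity, so the polytope lies in
  \<open>v\<close> plus the cone of vectors with nonnegative coordinates in this basis.
\<close>

lemma vertex_adapted_basis:
  fixes M :: "'a::euclidean_space set"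
  assumes uni: "unimodular M S" and v: "v extreme_point_of (convex hull S)"
    and M: "span M = UNIV"
  obtains B where "lattice_basis B M" "\<And>b. b \<in> B \<Longrightarrow> v + b \<in> S"
    "\<And>x b. x \<in> convex hull S \<Longrightarrow> b \<in> B \<Longrightarrow> 0 \<le> representation B (x - v) b"
proof -
  define \<E> where "\<E> = {E. E edge_of (convex hull S) \<and> v \<in> E}"
  obtain w where w: "\<And>E. E \<in> \<E> \<Longrightarrow> w E \<in> E \<inter> S"
    and bas: "lattice_basis ((\<lambda>E. w E - v) ` \<E>) M"
    using uni v unfolding unimodular_def Let_def \<E>_def by blast
  define B where "B = (\<lambda>E. w E - v) ` \<E>"
  have LB: "lattice_basis B M" using bas by (simp add: B_def)
  then have ind: "independent B" by (simp add: lattice_basis_def)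
  have sp: "span B = UNIV" using lattice_basis_span[OF LB] M by simp
  define C where "C = {x. \<forall>b\<in>B. 0 \<le> representation B x b}"
  have cone: "convex C" "cone C" "0 \<in> C"
    using ind sp by (auto simp: C_def convex_def cone_def representation_add representation_scale representation_zero)
  have edge: "\<exists>w\<in>E. w \<noteq> v \<and> w - v \<in> C" if "E edge_of (convex hull S)" "v \<in> E" for E
  proof -
    have E: "E \<in> \<E>" using that by (simp add: \<E>_def)
    then have b: "w E - v \<in> B" by (simp add: B_def)
    then have "w E \<noteq> v" using ind dependent_zero by force
    moreover have "w E - v \<in> C" using representation_basis[OF ind b] by (simp add: C_def)
    ultimately show ?thesis using w[OF E] by blast
  qed
  have "finite S" using uni by (simp add: unimodular_def)
  then have "x - v \<in> C" if "x \<in> convex hull S" for x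
    using polytope_in_cone_of_edges[OF _ v cone edge that] by blast
  then have "0 \<le> representation B (x - v) b" if "x \<in> convex hull S" "b \<in> B" for x b
    using that by (auto simp: C_def)
  moreover have "v + b \<in> S" if "b \<in> B" for b
    using that w by (auto simp: B_def)
  ultimately show ?thesis using that LB by blast
qed

text \<open>
  For the vertex \<open>v\<close> of a face \<open>F\<close> whose normal cone is \<open>\<tau>\<close>, take an adapted basis \<open>B\<close>. Any nonzero \<open>z\<close>
  in \<open>\<tau>\<close> is nonnegative on \<open>B\<close> and constant on \<open>F\<close>, so if it is positive at \<open>b\<^sub>0\<close>, then \<open>F\<close> has
  coordinate \<open>0\<close> along \<open>b\<^sub>0\<close>. Consequently the dual vector of \<open>b\<^sub>0\<close> is in \<open>\<tau>\<close> too, and it spans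
  \<open>\<tau>\<close> because \<open>\<tau>\<close> has dimension one.
\<close>

lemma normal_fan_ray:
  fixes M :: "'a::euclidean_space set"
  assumes uni: "unimodular M S" and M: "span M = UNIV"
    and \<tau>: "\<tau> \<in> rays (normal_fan (convex hull S))"
  obtains v B b0 where "v \<in> S" "lattice_basis B M" "b0 \<in> B" "\<And>b. b \<in> B \<Longrightarrow> v + b \<in> S"
    "\<And>x b. x \<in> convex hull S \<Longrightarrow> b \<in> B \<Longrightarrow> 0 \<le> representation B (x - v) b"
    "\<tau> = {c *\<^sub>R dual_vec B b0 | c. 0 \<le> c}"
proof -
  let ?P = "convex hull S"
  have finS: "finite S" using uni by (simp add: unimodular_def)
  obtain F where F: "F face_of ?P" "F \<noteq> {}" "\<tau> = normal_cone ?P F" and dim: "dim \<tau> = 1"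
    using \<tau> by (auto simp: rays_def normal_fan_def)
  have "compact F" "convex F"
    using face_of_imp_compact[OF _ _ F(1)] face_of_imp_convex[OF F(1)] finite_imp_compact_convex_hull[OF finS]
    by auto
  then obtain v where v: "v extreme_point_of F" using extreme_point_exists_convex F(2) by blast
  then have vF: "v \<in> F" by (simp add: extreme_point_of_def)
  have vP: "v extreme_point_of ?P" using v extreme_point_of_face[OF F(1)] by blast
  have vS: "v \<in> S" using extreme_point_of_convex_hull[OF vP] .
  obtain B where B: "lattice_basis B M" and BS: "\<And>b. b \<in> B \<Longrightarrow> v + b \<in> S"
    and pos: "\<And>x b. x \<in> ?P \<Longrightarrow> b \<in> B \<Longrightarrow> 0 \<le> representation B (x - v) b"
    using vertex_adapted_basis[OF uni vP M] by blast
  have ind: "independent B" using B by (simp add: lattice_basis_def)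
  have fin: "finite B" using independent_imp_finite[OF ind] .
  have sp: "span B = UNIV" using lattice_basis_span[OF B] M by simp
  have FP: "F \<subseteq> ?P" using face_of_imp_subset[OF F(1)] .
  have \<tau>_nonneg: "0 \<le> inner z b" if "z \<in> \<tau>" "b \<in> B" for z b
  proof -
    have "v + b \<in> ?P" using BS[OF that(2)] by (rule hull_inc)
    then have "0 \<le> inner z (v + b - v)" using that(1) vF unfolding F(3) normal_cone_def by blast
    then show ?thesis by simp
  qed
  have \<tau>_zero: "inner z (y - v) = 0" if "z \<in> \<tau>" "y \<in> F" for z y
  proof -
    have "0 \<le> inner z (y - v)" "0 \<le> inner z (v - y)"
      using that vF FP unfolding F(3) normal_cone_def by blast+
    then show ?thesis by (simp add: inner_diff_right)
  qed
  have "\<not> \<tau> \<subseteq> {0}" using dim dim_eq_0[of \<tau>] by linarith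
  then obtain z where z: "z \<in> \<tau>" "z \<noteq> 0" by blast
  have "\<exists>b\<in>B. inner z b \<noteq> 0"
  proof (rule ccontr)
    assume "\<not> ?thesis"
    then have "inner z z = 0" by (subst inner_eq_sum_representation[OF ind sp]) simp
    then show False using z by simp
  qed
  then obtain b0 where b0: "b0 \<in> B" "inner z b0 \<noteq> 0" by blast
  have F0: "representation B (y - v) b0 = 0" if y: "y \<in> F" for y
  proof -
    have "representation B (y - v) b0 * inner z b0 = 0"
    proof (rule sum_nonneg_0[OF fin _ _ b0(1)])
      show "(\<Sum>b\<in>B. representation B (y - v) b * inner z b) = 0"
        using inner_eq_sum_representation[OF ind sp, of z "y - v"] \<tau>_zero[OF z(1) y] by simp
      show "0 \<le> representation B (y - v) b * inner z b" if "b \<in> B" for b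
        using pos[OF _ that] \<tau>_nonneg[OF z(1) that] y FP by (simp add: subset_eq)
    qed
    then show ?thesis using b0(2) by simp
  qed
  let ?u = "dual_vec B b0"
  have u: "inner ?u x = representation B x b0" for x by (rule inner_dual_vec[OF ind sp])
  have ub0: "inner ?u b0 = 1" using representation_basis[OF ind b0(1)] by (simp add: u)
  have ray: "c *\<^sub>R ?u \<in> \<tau>" if "0 \<le> c" for c
  proof -
    have "0 \<le> inner (c *\<^sub>R ?u) (x - y)" if "x \<in> ?P" "y \<in> F" for x y
    proof -
      have "inner ?u (x - y) = inner ?u (x - v) - inner ?u (y - v)" by (simp add: inner_diff_right)
      also have "\<dots> = representation B (x - v) b0" using F0[OF that(2)] by (simp add: u)
      finally show ?thesis using pos[OF that(1) b0(1)] \<open>0 \<le> c\<close> by simp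
    qed
    then show ?thesis by (simp add: F(3) normal_cone_def)
  qed
  have "?u \<noteq> 0" using ub0 by auto
  then have "\<tau> \<subseteq> span {?u}"
    using ray[of 1] dim by (intro card_ge_dim_independent) auto
  have "\<tau> = {c *\<^sub>R ?u | c. 0 \<le> c}"
  proof
    show "\<tau> \<subseteq> {c *\<^sub>R ?u | c. 0 \<le> c}"
    proof
      fix y assume y: "y \<in> \<tau>"
      then obtain c where c: "y = c *\<^sub>R ?u" using \<open>\<tau> \<subseteq> span {?u}\<close> by (auto simp: span_singleton)
      then have "0 \<le> c" using \<tau>_nonneg[OF y b0(1)] ub0 by simp
      then show "y \<in> {c *\<^sub>R ?u | c. 0 \<le> c}" using c by blast
    qed
  qed (use ray in blast)
  then show ?thesis using that[OF vS B b0(1) BS pos] by blast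
qed

text \<open>
  The facet contains \<open>v\<close> and all \<open>v + b\<close> with \<open>b \<noteq> b\<^sub>0\<close>, so an inner normal vanishes on these \<open>b\<close> and
  is a nonnegative multiple of the dual vector of \<open>b\<^sub>0\<close>. That vector takes the value \<open>1\<close> on the
  lattice, hence it is primitive.
\<close>

lemma primitive_inner_normal_eq_dual_vec:
  fixes B :: "'a::euclidean_space set"
  assumes B: "lattice_basis B M" and sp: "span B = UNIV" and b0: "b0 \<in> B"
    and v: "v \<in> \<Delta>" and Bv: "\<And>b. b \<in> B \<Longrightarrow> v + b \<in> \<Delta>"
    and pos: "\<And>x. x \<in> \<Delta> \<Longrightarrow> 0 \<le> representation B (x - v) b0"
    and F: "F = {x \<in> \<Delta>. representation B (x - v) b0 = 0}"
  shows "primitive_inner_normal M \<Delta> F = dual_vec B b0"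
proof -
  let ?u = "dual_vec B b0"
  have ind: "independent B" and M: "M = int_span B" using B by (auto simp: lattice_basis_def)
  have u: "inner ?u x = representation B x b0" for x by (rule inner_dual_vec[OF ind sp])
  have ub: "inner ?u b = (if b = b0 then 1 else 0)" if "b \<in> B" for b
    using representation_basis[OF ind that] by (auto simp: u)
  have udual: "?u \<in> dual_lattice M"
    using representation_int_span[OF ind] by (auto simp: dual_lattice_def u M)
  have b0M: "b0 \<in> M" using lattice_basis_subset[OF B] b0 by blast
  have u0: "?u \<noteq> 0" using ub[OF b0] by auto
  have unit: "\<bar>k\<bar> = 1" if w: "w \<in> dual_lattice M" "?u = of_int k *\<^sub>R w" for k :: int and w
  proof -
    have "inner w b0 \<in> \<int>" using w(1) b0M by (auto simp: dual_lattice_def)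
    then obtain j where j: "inner w b0 = of_int j" by (elim Ints_cases)
    have "1 = inner (of_int k *\<^sub>R w) b0" using ub[OF b0] w(2) by simp
    then have "real_of_int (k * j) = 1" by (simp add: j)
    then have "k * j = 1" by linarith
    then show ?thesis by (auto simp: zmult_eq_1_iff)
  qed
  have prim: "primitive_vector (dual_lattice M) ?u"
    using udual u0 unit by (auto simp: primitive_vector_def)
  have normal: "?u \<in> normal_cone \<Delta> F"
  proof -
    have "0 \<le> inner ?u (x - y)" if "x \<in> \<Delta>" "y \<in> F" for x y
    proof -
      have "inner ?u (x - y) = inner ?u (x - v) - inner ?u (y - v)" by (simp add: inner_diff_right)
      also have "\<dots> = representation B (x - v) b0" using that(2) by (simp add: u F)
      finally show ?thesis using pos[OF that(1)] by simp
    qed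
    then show ?thesis by (simp add: normal_cone_def)
  qed
  have uniq: "z = ?u" if z: "primitive_vector (dual_lattice M) z" "z \<in> normal_cone \<Delta> F" for z
  proof -
    have vF: "v \<in> F" using v by (simp add: F u[symmetric])
    have nonneg: "0 \<le> inner z b" if "b \<in> B" for b
    proof -
      have "0 \<le> inner z (v + b - v)" using z(2) Bv[OF that] vF unfolding normal_cone_def by blast
      then show ?thesis by simp
    qed
    have zero: "inner z b = 0" if "b \<in> B" "b \<noteq> b0" for b
    proof -
      have "v + b \<in> F" using Bv[OF that(1)] ub[OF that(1)] that(2) by (simp add: F u)
      then have "0 \<le> inner z (v - (v + b))" using z(2) v unfolding normal_cone_def by blast
      then show ?thesis using nonneg[OF that(1)] by simp
    qed
    have zu: "z = inner z b0 *\<^sub>R ?u"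
    proof (rule vector_eq_ldot[THEN iffD1], rule allI)
      fix x
      have "inner z x = (\<Sum>b\<in>B. representation B x b * inner z b)"
        by (rule inner_eq_sum_representation[OF ind sp])
      also have "\<dots> = (\<Sum>b\<in>{b0}. representation B x b * inner z b)"
        using zero b0 independent_imp_finite[OF ind] by (intro sum.mono_neutral_right) auto
      finally show "inner x z = inner x (inner z b0 *\<^sub>R ?u)"
        by (simp add: u inner_commute[of x])
    qed
    have "inner z b0 \<in> \<int>" using z(1) b0M by (auto simp: primitive_vector_def dual_lattice_def)
    then obtain j where j: "inner z b0 = of_int j" by (elim Ints_cases)
    then have "\<bar>j\<bar> = 1" using z(1) zu udual unfolding primitive_vector_def by metis
    moreover have "0 \<le> j" using nonneg[OF b0] j by simp
    ultimately show ?thesis using zu j by simp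
  qed
  show ?thesis unfolding primitive_inner_normal_def
  proof (rule the_equality)
    show "primitive_vector (dual_lattice M) ?u \<and> ?u \<in> normal_cone \<Delta> F" using prim normal ..
  qed (elim conjE, rule uniq)
qed

section \<open>The initial part of \<open>\<mu>(p)\<close>\<close>

theorem theorem3p14:
  fixes M :: "'a::euclidean_space set" and p :: "'a \<Rightarrow>\<^sub>0 complex" and \<tau> :: "'a set"
  assumes "full_lattice M"
    and "p \<in> laurent_polys M" and "p \<noteq> 0"
    and "unimodular M (Poly_Mapping.keys p)"
    and "\<tau> \<in> rays (normal_fan (newton_polytope p))"
  shows "init_part \<tau> (mu M p) =
    mu M (init_part \<tau> p) *
    restrict_supp p
      (adjacent_polytope M (newton_polytope p) (cone_face (newton_polytope p) \<tau>))"
proof -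
  let ?P = "newton_polytope p"
  have hull: "?P = convex hull (keys p)" by (simp add: newton_polytope_def)
  obtain B' where "lattice_basis B' M" "span B' = UNIV" using assms(1) by (auto simp: full_lattice_def)
  then have spM: "span M = UNIV" using lattice_basis_span by metis
  obtain v B b0 where v: "v \<in> keys p" and B: "lattice_basis B M" and b0: "b0 \<in> B"
    and Bv: "\<And>b. b \<in> B \<Longrightarrow> v + b \<in> keys p"
    and pos': "\<And>x b. x \<in> convex hull (keys p) \<Longrightarrow> b \<in> B \<Longrightarrow> 0 \<le> representation B (x - v) b"
    and \<tau>: "\<tau> = {c *\<^sub>R dual_vec B b0 | c. 0 \<le> c}"
    by (rule normal_fan_ray[OF assms(4) spM assms(5)[unfolded hull]]) (rule that)
  note pos = pos'[folded hull]
  have ind: "independent B" and MB: "M = int_span B" using B by (auto simp: lattice_basis_def)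
  have fin: "finite B" using independent_imp_finite[OF ind] .
  have sp: "span B = UNIV" using lattice_basis_span[OF B] spM by simp
  define u where "u = dual_vec B b0"
  define h where "h = inner u v"
  have rep: "representation B x b = inner (dual_vec B b) x" for x b
    by (rule inner_dual_vec[OF ind sp, symmetric])
  have dual: "inner (dual_vec B b) c = (if b = c then 1 else 0)" if "c \<in> B" for b c
    using representation_basis[OF ind that] by (auto simp flip: rep)
  have keysP: "keys p \<subseteq> ?P" unfolding hull by (rule hull_subset)
  have nat: "inner (dual_vec B b) (m - v) \<in> \<nat>" if "m \<in> keys p" "b \<in> B" for m b
  proof -
    have "m - v \<in> int_span B"
      using that v assms(2) by (intro int_span_diff) (auto simp: laurent_polys_def MB)
    then have "inner (dual_vec B b) (m - v) \<in> \<int>"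
      unfolding rep[symmetric] by (rule representation_int_span[OF ind])
    moreover have "0 \<le> inner (dual_vec B b) (m - v)"
      unfolding rep[symmetric] using pos that keysP by blast
    ultimately show ?thesis by (simp add: Nats_altdef2)
  qed
  have lev: "inner u m = h \<or> h + 1 \<le> inner u m" if m: "m \<in> keys p" for m
  proof -
    obtain n :: nat where "inner u (m - v) = real n"
      using nat[OF m b0] by (auto simp: u_def elim: Nats_cases)
    then show ?thesis by (cases n) (auto simp: h_def inner_diff_right)
  qed
  obtain cs where cs: "set cs = B - {b0}" "distinct cs" using finite_distinct_list[of "B - {b0}"] fin by auto
  define k where "k = length cs"
  define bs where "bs = cs @ [b0]"
  have bs: "set bs = B" "distinct bs" "length bs = Suc k"
    using cs b0 by (auto simp: bs_def k_def)
  have csB: "cs ! i \<in> B" if "i < k" for i using that cs(1) nth_mem[of i cs] by (auto simp: k_def)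
  define p0 where "p0 = restrict_supp p (level u h)"
  define p1 where "p1 = restrict_supp p (level u (h + 1))"
  have keys0: "keys p0 = keys p \<inter> level u h" by (simp add: p0_def)
  have v0: "v \<in> keys p0" using v by (simp add: keys0 h_def)
  have Bv0: "v + b \<in> keys p0" if "b \<in> B" "b \<noteq> b0" for b
    using Bv[OF that(1)] dual[OF that(1), of b0] that(2) by (simp add: keys0 h_def u_def inner_add_right)

  \<comment> \<open>Since \<open>\<tau>\<close> is generated by \<open>u\<close>, the facet is where the last coordinate \<open>u - h\<close> vanishes, and the
    adjacent polytope is where it equals \<open>1\<close>.\<close>
  have face: "cone_face ?P \<tau> = {x \<in> ?P. representation B (x - v) b0 = 0}"
  proof (rule Set.set_eqI, rule iffI)
    fix y assume y: "y \<in> cone_face ?P \<tau>"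
    have "u \<in> \<tau>" unfolding \<tau> u_def by (auto intro!: exI[of _ 1])
    then have "0 \<le> inner u (v - y)" using y v keysP by (auto simp: cone_face_def)
    moreover have "0 \<le> inner u (y - v)"
      using y pos[OF _ b0, of y] by (simp add: cone_face_def rep u_def)
    ultimately show "y \<in> {x \<in> ?P. representation B (x - v) b0 = 0}"
      using y by (simp add: cone_face_def rep u_def inner_diff_right)
  next
    fix y assume y: "y \<in> {x \<in> ?P. representation B (x - v) b0 = 0}"
    have "0 \<le> inner z (x - y)" if z: "z \<in> \<tau>" and x: "x \<in> ?P" for z x
    proof -
      obtain c where "z = c *\<^sub>R u" "0 \<le> c" using z by (auto simp: \<tau> u_def)
      moreover have "0 \<le> inner u (x - y)"
        using pos[OF x b0] y by (simp add: rep u_def inner_diff_right)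
      ultimately show ?thesis by simp
    qed
    then show "y \<in> cone_face ?P \<tau>" using y by (simp add: cone_face_def)
  qed
  have facet_level: "inner u y = h" if "y \<in> cone_face ?P \<tau>" for y
    using that by (simp add: face rep u_def h_def inner_diff_right)
  have normal: "primitive_inner_normal M ?P (cone_face ?P \<tau>) = u"
    unfolding u_def using v Bv keysP pos b0 by (intro primitive_inner_normal_eq_dual_vec[OF B sp b0 _ _ _ face]) auto
  have adj: "restrict_supp p (adjacent_polytope M ?P (cone_face ?P \<tau>)) = p1"
    unfolding p1_def
  proof (rule restrict_supp_cong, rule Set.set_eqI, rule iffI)
    fix x assume x: "x \<in> keys p \<inter> adjacent_polytope M ?P (cone_face ?P \<tau>)"
    have "v \<in> cone_face ?P \<tau>" using v keysP by (auto simp: face rep)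
    then show "x \<in> keys p \<inter> level u (h + 1)"
      using x by (auto simp: adjacent_polytope_def normal h_def inner_diff_right)
  next
    fix x assume "x \<in> keys p \<inter> level u (h + 1)"
    then show "x \<in> keys p \<inter> adjacent_polytope M ?P (cone_face ?P \<tau>)"
      using keysP facet_level by (auto simp: adjacent_polytope_def normal inner_diff_right)
  qed
  have p0_ne: "p0 \<noteq> 0" using v0 by auto
  have init: "init_part \<tau> p = p0"
    unfolding p0_def
  proof (rule init_part_ray)
    show "\<tau> = {c *\<^sub>R u | c. 0 \<le> c}" by (simp add: \<tau> u_def)
    show "h \<le> inner u m" if "m \<in> keys p" for m using lev[OF that] by auto
  qed (use p0_ne in \<open>simp add: p0_def\<close>)

  \<comment> \<open>The differences of exponents contain \<open>B\<close>, so the lattice of \<open>p\<close> is all of \<open>M\<close>.\<close>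
  let ?D = "\<lambda>p. {x - y | x y. x \<in> keys p \<and> y \<in> keys p}"
  have "B \<subseteq> ?D p"
  proof
    fix b assume "b \<in> B"
    moreover have "b = (v + b) - v" by simp
    ultimately show "b \<in> ?D p" using Bv[of b] v by blast
  qed
  then have "span (?D p) = UNIV" using span_mono[of B "?D p"] sp by blast
  then have "difference_lattice M p = M" by (simp add: difference_lattice_def)
  then have mu_p: "mu M p = Determinant.det (gram (Suc (Suc k)) (affine_coord bs v) p)"
    using mu_eq_det_gram[OF assms(1,2) v bs(2)] bs B by simp

  \<comment> \<open>The lattice of the initial part has the basis \<open>B - {b0}\<close>. The element \<open>b0\<close> comes last in \<open>bs\<close>, so
    the first \<open>Suc k\<close> coordinates of \<open>p\<close> are the coordinates of the initial part.\<close>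
  have rep_bs: "representation (set bs) (m - v) b = inner (dual_vec B b) (m - v)" for m b
    by (simp add: bs rep)
  have diff_cs: "x - y \<in> span (set cs)" if "x \<in> keys p0" "y \<in> keys p0" for x y
    unfolding cs(1)
    by (rule span_delete[OF ind]) (use that in \<open>auto simp: sp rep keys0 inner_diff_right u_def\<close>)
  have "span (?D p0) = span (set cs)"
  proof
    show "span (?D p0) \<subseteq> span (set cs)" using diff_cs by (intro span_minimal) auto
    have "set cs \<subseteq> ?D p0"
    proof
      fix b assume "b \<in> set cs"
      then have "b \<in> B" "b \<noteq> b0" using cs(1) by auto
      moreover have "b = (v + b) - v" by simp
      ultimately show "b \<in> ?D p0" using Bv0[of b] v0 by blast
    qed
    then show "span (set cs) \<subseteq> span (?D p0)" by (rule span_mono)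
  qed
  then have "lattice_basis (set cs) (difference_lattice M p0)"
    unfolding difference_lattice_def by (intro lattice_basis_Int_span[OF B]) (auto simp: cs)
  moreover have "p0 \<in> laurent_polys M" using assms(2) by (auto simp: laurent_polys_def keys0)
  ultimately have "mu M p0 = Determinant.det (gram (Suc k) (affine_coord cs v) p0)"
    unfolding k_def using mu_eq_det_gram[OF assms(1) _ v0 cs(2)] by blast
  also have "gram (Suc k) (affine_coord cs v) p0 = gram (Suc k) (affine_coord bs v) p0"
  proof (rule gram_cong)
    fix i m assume i: "i < Suc k" and m: "m \<in> keys p0"
    have "representation (set bs) (m - v) = representation (set cs) (m - v)"
      by (rule representation_extend) (use ind cs bs diff_cs[OF m v0] in auto)
    then show "affine_coord cs v i m = affine_coord bs v i m"
      using i by (cases i) (auto simp: bs_def nth_append k_def)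
  qed
  finally have mu_p0: "mu M p0 = Determinant.det (gram (Suc k) (affine_coord bs v) p0)" .

  \<comment> \<open>The lowest conceivable level of \<open>\<mu>(p)\<close> is \<open>(n + 1) h + 1\<close>, where \<open>n = Suc k\<close>.\<close>
  have last: "affine_coord bs v (Suc k) m = complex_of_real (inner u m - h)" for m
    by (simp add: rep_bs) (simp add: bs_def k_def u_def h_def inner_diff_right)
  define K where "K = real (Suc (Suc k)) * h + 1"
  have mu_level: "restrict_supp (mu M p) (level u K) = mu M p0 * p1"
    unfolding mu_p mu_p0 unfolding K_def p0_def p1_def
    by (rule gram_level(1)) (erule lev, rule last)
  have mu_ge: "K \<le> inner u m" if "m \<in> keys (mu M p)" for m
    unfolding K_def
    by (rule gram_level(2)[OF _ _ that[unfolded mu_p]]) (erule lev, rule last)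
  have "mu M p0 \<noteq> 0"
    unfolding mu_p0
  proof (rule det_gram_nonzero[where u = "\<lambda>i. dual_vec B (cs ! i)" and b = "\<lambda>i. cs ! i" and v = v])
    show "affine_coord bs v (Suc i) m = complex_of_real (inner (dual_vec B (cs ! i)) (m - v))"
      if "i < k" for i m
      using that by (simp add: rep_bs) (simp add: bs_def nth_append k_def)
    show "inner (dual_vec B (cs ! i)) (m - v) \<in> \<nat>" if "i < k" "m \<in> keys p0" for i m
      using nat[of m "cs ! i"] that csB by (simp add: keys0)
    show "v + cs ! i \<in> keys p0" if "i < k" for i
      using Bv0[of "cs ! i"] cs nth_mem[of i cs] that by (auto simp: k_def)
    show "inner (dual_vec B (cs ! i)) (cs ! j) = (if i = j then 1 else 0)" if "i < k" "j < k" for i j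
      using dual[OF csB[OF that(2)], of "cs ! i"] nth_eq_iff_index_eq[OF cs(2), of i j] that
      by (simp add: k_def)
    show "m = v" if m: "m \<in> keys p0" and z: "\<And>i. i < k \<Longrightarrow> inner (dual_vec B (cs ! i)) (m - v) = 0" for m
    proof -
      have "representation B (m - v) b = 0" if "b \<in> B" for b
      proof (cases "b = b0")
        case True
        then show ?thesis using m by (simp add: rep keys0 u_def h_def inner_diff_right)
      next
        case False
        then have "b \<in> set cs" using that cs(1) by simp
        then obtain i where "i < k" "b = cs ! i" unfolding in_set_conv_nth k_def by blast
        then show ?thesis using z by (simp add: rep)
      qed
      then have "(\<Sum>b\<in>B. representation B (m - v) b *\<^sub>R b) = 0" by simp
      then show ?thesis using sum_representation_eq[OF ind, of "m - v" B] sp fin by simp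
    qed
  qed (use v0 in simp_all)
  moreover have "v + b0 \<in> keys p1"
    using Bv[OF b0] dual[OF b0, of b0] by (simp add: p1_def h_def u_def inner_add_right)
  then have "p1 \<noteq> 0" by (metis empty_iff keys_zero)
  ultimately have "mu M p0 * p1 \<noteq> 0" by (rule group_algebra_no_zero_divisors)
  then have "init_part \<tau> (mu M p) = mu M p0 * p1"
    using init_part_ray[OF \<tau>[folded u_def] mu_ge] by (simp add: mu_level)
  then show ?thesis by (simp add: init adj)
qed

end
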